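(* Let $\pi:(X,T)\to(Y,T)$ be an almost proximal extension of minimal flows. Then one of the following holds: (1) $\pi$ is almost finite to one; (2) there is a residual subset $Y_0\subseteq Y$ such that for every $y\in Y_0$ the fiber $\pi^{-1}(y)$ contains an uncountable strongly scrambled set.
   Context: $T$ is an infinite countable discrete group. A flow $(X,T)$ is a compact metric space $(X,d)$ with a continuous action of $T$; it is minimal if every orbit is dense. A point of a flow is minimal if its orbit closure is a minimal flow. An extension (factor map) $\pi:(X,T)\to(Y,T)$ is a continuous surjective $T$-equivariant map. Powers $X^n$ carry the diagonal action $t(x_1,\dots,x_n)=(tx_1,\dots,tx_n)$. A subset $A\subseteq X$ is an almost periodic set if for every finite subset $\{x_1,\dots,x_n\}$ of $A$ the point $(x_1,\dots,x_n)$ is a minimal point of $(X^n,T)$. An extension $\pi$ of minimal flows is almost proximal if for each $y\in Y$ there is $N\in\mathbb{N}$ such that every almost periodic subset of $\pi^{-1}(y)$ has cardinality at most $N$. It is almost finite to one if some fiber $\pi^{-1}(y)$ is finite. A pair $(x,x')$ is proximal if $\inf_{t\in T}d(tx,tx')=0$. A point $z$ of a flow is recurrent if for every neighbourhood $U$ of $z$ the set $\{t\in T: tz\in U\}$ is infinite. A pair $(x,x')\in X^2$ is a strong Li-Yorke pair if it is proximal and is a recurrent point of $(X^2,T)$. A subset $S\subseteq X$ is strongly scrambled if every pair of distinct points of $S$ is a strong Li-Yorke pair. *)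

theory Defs
  imports "HOL-Analysis.Analysis" "HOL-Algebra.Group_Action"
begin

text \<open>
  Flows live on a compact subset of a metric space. The acting group is discrete, so continuity of
  the action means continuity of every translation. As usual for \<^const>\<open>group_action\<close>,
  the translations are extensional: they are \<^const>\<open>undefined\<close> off the phase space.
\<close>

definition flow ::
  "('t, 'r) monoid_scheme \<Rightarrow> 'x::metric_space set \<Rightarrow> ('t \<Rightarrow> 'x \<Rightarrow> 'x) \<Rightarrow> bool" where
  "flow T X \<phi> \<longleftrightarrow>
     compact X \<and> group_action T X \<phi> \<and> (\<forall>t\<in>carrier T. continuous_on X (\<phi> t))"

definition minimal_flow ::
  "('t, 'r) monoid_scheme \<Rightarrow> 'x::metric_space set \<Rightarrow> ('t \<Rightarrow> 'x \<Rightarrow> 'x) \<Rightarrow> bool" where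
  "minimal_flow T X \<phi> \<longleftrightarrow> flow T X \<phi> \<and> (\<forall>x\<in>X. closure (orbit T \<phi> x) = X)"

text \<open>
  The closure is taken in the ambient type; for a point of a flow it agrees with the closure in the
  phase space, which is compact and hence closed.
\<close>

definition orbit_closure ::
  "('t, 'r) monoid_scheme \<Rightarrow> ('t \<Rightarrow> 'x \<Rightarrow> 'x) \<Rightarrow> 'x::metric_space \<Rightarrow> 'x set" where
  "orbit_closure T \<phi> x = closure (orbit T \<phi> x)"

definition minimal_point ::
  "('t, 'r) monoid_scheme \<Rightarrow> ('t \<Rightarrow> 'x \<Rightarrow> 'x) \<Rightarrow> 'x::metric_space \<Rightarrow> bool" where
  "minimal_point T \<phi> x \<longleftrightarrow>
     minimal_flow T (orbit_closure T \<phi> x) (\<lambda>t. restrict (\<phi> t) (orbit_closure T \<phi> x))"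

definition extension ::
  "('t, 'r) monoid_scheme \<Rightarrow> 'x::metric_space set \<Rightarrow> ('t \<Rightarrow> 'x \<Rightarrow> 'x) \<Rightarrow>
   'y::metric_space set \<Rightarrow> ('t \<Rightarrow> 'y \<Rightarrow> 'y) \<Rightarrow> ('x \<Rightarrow> 'y) \<Rightarrow> bool" where
  "extension T X \<phi> Y \<psi> \<pi> \<longleftrightarrow>
     flow T X \<phi> \<and> flow T Y \<psi> \<and> continuous_on X \<pi> \<and> \<pi> ` X = Y \<and>
     (\<forall>t\<in>carrier T. \<forall>x\<in>X. \<pi> (\<phi> t x) = \<psi> t (\<pi> x))"

definition fiber :: "'x set \<Rightarrow> ('x \<Rightarrow> 'y) \<Rightarrow> 'y \<Rightarrow> 'x set" where
  "fiber X \<pi> y = {x\<in>X. \<pi> x = y}"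

text \<open>
  The power $X^n$ is the set of extensional functions on \<open>{..<n}\<close> with values in \<open>X\<close>. The metric
  on \<^typ>\<open>nat \<Rightarrow> 'x::metric_space\<close> induces the product topology.
\<close>

definition power_space :: "'x set \<Rightarrow> nat \<Rightarrow> (nat \<Rightarrow> 'x) set" where
  "power_space X n = ({..<n} \<rightarrow>\<^sub>E X)"

definition power_action ::
  "'x set \<Rightarrow> nat \<Rightarrow> ('t \<Rightarrow> 'x \<Rightarrow> 'x) \<Rightarrow> 't \<Rightarrow> (nat \<Rightarrow> 'x) \<Rightarrow> (nat \<Rightarrow> 'x)" where
  "power_action X n \<phi> t = (\<lambda>x\<in>power_space X n. \<lambda>i\<in>{..<n}. \<phi> t (x i))"

definition pair_action :: "'x set \<Rightarrow> ('t \<Rightarrow> 'x \<Rightarrow> 'x) \<Rightarrow> 't \<Rightarrow> 'x \<times> 'x \<Rightarrow> 'x \<times> 'x" where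
  "pair_action X \<phi> t = restrict (map_prod (\<phi> t) (\<phi> t)) (X \<times> X)"

text \<open>
  Tuples may list a point of \<open>A\<close> more than once; this does not affect minimality, because
  repeating coordinates is an equivariant embedding.
\<close>

definition almost_periodic_set ::
  "('t, 'r) monoid_scheme \<Rightarrow> 'x::metric_space set \<Rightarrow> ('t \<Rightarrow> 'x \<Rightarrow> 'x) \<Rightarrow> 'x set \<Rightarrow> bool" where
  "almost_periodic_set T X \<phi> A \<longleftrightarrow>
     A \<subseteq> X \<and> (\<forall>n. \<forall>x\<in>power_space A n. minimal_point T (power_action X n \<phi>) x)"

definition almost_proximal ::
  "('t, 'r) monoid_scheme \<Rightarrow> 'x::metric_space set \<Rightarrow> ('t \<Rightarrow> 'x \<Rightarrow> 'x) \<Rightarrow>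
   'y set \<Rightarrow> ('x \<Rightarrow> 'y) \<Rightarrow> bool" where
  "almost_proximal T X \<phi> Y \<pi> \<longleftrightarrow>
     (\<forall>y\<in>Y. \<exists>N::nat. \<forall>A\<subseteq>fiber X \<pi> y.
        almost_periodic_set T X \<phi> A \<longrightarrow> finite A \<and> card A \<le> N)"

definition almost_finite_to_one :: "'x set \<Rightarrow> 'y set \<Rightarrow> ('x \<Rightarrow> 'y) \<Rightarrow> bool" where
  "almost_finite_to_one X Y \<pi> \<longleftrightarrow> (\<exists>y\<in>Y. finite (fiber X \<pi> y))"

definition proximal_pair ::
  "('t, 'r) monoid_scheme \<Rightarrow> ('t \<Rightarrow> 'x \<Rightarrow> 'x) \<Rightarrow> 'x::metric_space \<Rightarrow> 'x \<Rightarrow> bool" where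
  "proximal_pair T \<phi> x x' \<longleftrightarrow> (INF t\<in>carrier T. dist (\<phi> t x) (\<phi> t x')) = 0"

definition recurrent_point ::
  "('t, 'r) monoid_scheme \<Rightarrow> ('t \<Rightarrow> 'z \<Rightarrow> 'z) \<Rightarrow> 'z::metric_space \<Rightarrow> bool" where
  "recurrent_point T \<phi> z \<longleftrightarrow>
     (\<forall>U. open U \<and> z \<in> U \<longrightarrow> infinite {t\<in>carrier T. \<phi> t z \<in> U})"

definition strong_Li_Yorke_pair ::
  "('t, 'r) monoid_scheme \<Rightarrow> 'x::metric_space set \<Rightarrow> ('t \<Rightarrow> 'x \<Rightarrow> 'x) \<Rightarrow> 'x \<Rightarrow> 'x \<Rightarrow> bool" where
  "strong_Li_Yorke_pair T X \<phi> x x' \<longleftrightarrow>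
     x \<in> X \<and> x' \<in> X \<and> proximal_pair T \<phi> x x' \<and> recurrent_point T (pair_action X \<phi>) (x, x')"

definition strongly_scrambled ::
  "('t, 'r) monoid_scheme \<Rightarrow> 'x::metric_space set \<Rightarrow> ('t \<Rightarrow> 'x \<Rightarrow> 'x) \<Rightarrow> 'x set \<Rightarrow> bool" where
  "strongly_scrambled T X \<phi> S \<longleftrightarrow>
     S \<subseteq> X \<and> (\<forall>x\<in>S. \<forall>x'\<in>S. x \<noteq> x' \<longrightarrow> strong_Li_Yorke_pair T X \<phi> x x')"

text \<open>A residual subset of \<open>Y\<close> contains a countable intersection of dense open subsets of \<open>Y\<close>.\<close>

definition residual_in :: "'y::topological_space set \<Rightarrow> 'y set \<Rightarrow> bool" where
  "residual_in Y R \<longleftrightarrow>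
     R \<subseteq> Y \<and> (\<exists>G :: nat \<Rightarrow> 'y set.
       (\<forall>n. openin (top_of_set Y) (G n) \<and> Y \<subseteq> closure (G n)) \<and> (\<Inter>n. G n) \<subseteq> R)"

end

theory Submission
  imports Defs "HOL-Combinatorics.Cycles"
begin

text \<open>
  Choose a minimal point \<open>z\<^sub>0\<close> of some power \<open>X\<^sup>N\<close> with \<open>N\<close> distinct coordinates in one fibre, \<open>N\<close> being
  maximal, and let \<open>M\<close> be its orbit closure. Maximality means that any finite part of a fibre can be
  moved arbitrarily close to the coordinates of a prescribed tuple in \<open>M\<close>. Hence the relative product
  \<open>E\<close> of \<open>X\<close> and \<open>M\<close> over \<open>Y\<close> is, over the points of \<open>Y\<close> at which \<open>E \<rightarrow> Y\<close> is open,
  topologically transitive under \<open>T\<close> together with the permutations of the \<open>N\<close> coordinates. So for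
  generic \<open>y\<close> a generic point of the fibre of \<open>E\<close> has a dense orbit. If the fibres of \<open>\<pi>\<close> are
  infinite, this makes the fibre over \<open>y\<close> perfect and yields a dense set of recurrent pairs in its
  square. As a fibre contains only boundedly many pairwise distal points, proximal pairs are dense
  in \<open>U \<times> U\<close> for some relatively open subset \<open>U\<close> of it, and a Mycielski argument in \<open>U\<close> gives
  the scrambled set.
\<close>

subsection \<open>Baire category in compact metric spaces\<close>

text \<open>Collapsing brings points close to coordinates of a tuple but does not control in which
  order; this is why permutations enter. Since \<open>M\<close> need not be invariant under them,
  \<open>act\<close> is a map of X x X^N that may leave \<open>E\<close>, and a dense orbit of a
  point of \<open>E\<close> is one whose images approach the points of \<open>E\<close>. The
  permutations disappear again at the end: those along which a generic point returns to itself are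
  closed under composition in a finite group, so the identity is one of them, and the point is
  recurrent under T alone. The tuple in a point (x, z) of \<open>E\<close> serves twice: as the
  frame onto which the fibre collapses, and, by its first coordinate, as the second point of the
  pair (x, z 0). Minimality of X makes every point of X such a first coordinate; hence recurrent
  pairs are dense in the square of a generic fibre. Almost proximality acts at different base
  points: at one point \<open>y0\<close> it bounds N, and at each generic y it bounds the number of
  pairwise distal points. Infinite fibres enter through perfectness, which turns a return into
  infinitely many returns.\<close>

lemma compact_countable_base:
  fixes K :: "'a::metric_space set"
  assumes "compact K"
  obtains \<B> where "countable \<B>" "\<And>B. B \<in> \<B> \<Longrightarrow> open B"
    "\<And>U p. open U \<Longrightarrow> p \<in> K \<Longrightarrow> p \<in> U \<Longrightarrow> \<exists>B\<in>\<B>. p \<in> B \<and> closure B \<subseteq> U"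
proof -
  have "\<exists>C. finite C \<and> C \<subseteq> K \<and> K \<subseteq> (\<Union>x\<in>C. ball x (inverse (Suc n)))" for n
  proof -
    have "K \<subseteq> (\<Union>x\<in>K. ball x (inverse (Suc n)))"
      by force
    then show ?thesis
      using compactE_image[OF assms, of K "\<lambda>x. ball x (inverse (Suc n))"] open_ball by metis
  qed
  then obtain C where C: "\<And>n. finite (C n)" "\<And>n. K \<subseteq> (\<Union>x\<in>C n. ball x (inverse (Suc n)))"
    by metis
  \<comment> \<open>A ball of radius below e/2 around a centre close to p lies in U together with
    its closure. The closures are for \<open>open_fiber_residual\<close>, where images have to be
    closed.\<close>
  let ?\<B> = "\<Union>n. (\<lambda>x. ball x (inverse (Suc n))) ` C n"
  show thesis
  proof
    show "countable ?\<B>"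
      using C(1) by (intro countable_UN countable_image) (auto intro: countable_finite)
    show "open B" if "B \<in> ?\<B>" for B
      using that by auto
    fix U p
    assume "open U" "p \<in> K" "p \<in> U"
    then obtain e where e: "e > 0" "ball p e \<subseteq> U"
      by (meson openE)
    obtain n where n: "inverse (Suc n) < e / 2"
      using reals_Archimedean[of "e / 2"] e by auto
    obtain x where x: "x \<in> C n" "p \<in> ball x (inverse (Suc n))"
      using C(2) \<open>p \<in> K\<close> by blast
    have "cball x (inverse (Suc n)) \<subseteq> ball p e"
    proof
      fix q
      assume "q \<in> cball x (inverse (Suc n))"
      then show "q \<in> ball p e"
        using x(2) n dist_triangle[of p q x] by (auto simp: dist_commute)
    qed
    then have "closure (ball x (inverse (Suc n))) \<subseteq> U"
      using e(2) closure_minimal[OF ball_subset_cball closed_cball] by blast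
    then show "\<exists>B\<in>?\<B>. p \<in> B \<and> closure B \<subseteq> U"
      using x by blast
  qed
qed

lemma compact_Baire:
  fixes K :: "'a::metric_space set"
  assumes K: "compact K" and U: "open U" "U \<inter> K \<noteq> {}" and count: "countable \<G>"
    and op: "\<And>G. G \<in> \<G> \<Longrightarrow> openin (top_of_set K) G"
    and dense: "\<And>G V. G \<in> \<G> \<Longrightarrow> open V \<Longrightarrow> V \<subseteq> U \<Longrightarrow> V \<inter> K \<noteq> {} \<Longrightarrow> V \<inter> G \<noteq> {}"
  obtains x where "x \<in> U \<inter> K" "\<And>G. G \<in> \<G> \<Longrightarrow> x \<in> G"
proof -
  \<comment> \<open>The sets are dense only inside U. Adding the exterior of U \<inter> K makes them
    dense in all of K, and a common point that lies in U avoids that exterior.\<close>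
  define C where "C = - closure (U \<inter> K)"
  define \<H> where "\<H> = (\<lambda>G. G \<union> (C \<inter> K)) ` \<G>"
  have GK: "G \<subseteq> K" if "G \<in> \<G>" for G
    using op[OF that] openin_imp_subset by blast
  have "top_of_set K closure_of \<Inter>\<H> = topspace (top_of_set K)"
  proof (rule Baire_category)
    show "completely_metrizable_space (top_of_set K) \<or>
        locally_compact_space (top_of_set K) \<and> regular_space (top_of_set K)"
      using K by (simp add: compact_imp_locally_compact_space compact_space_subtopology
          regular_space_euclidean regular_space_subtopology)
    show "countable \<H>"
      using count by (simp add: \<H>_def)
    fix H
    assume "H \<in> \<H>"
    then obtain G where G: "G \<in> \<G>" "H = G \<union> (C \<inter> K)"
      by (auto simp: \<H>_def)
    have "openin (top_of_set K) (C \<inter> K)"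
      by (simp add: C_def openin_open_Int inf_commute open_Compl)
    then have "openin (top_of_set K) H"
      using op[OF G(1)] G(2) by auto
    moreover have "K \<subseteq> closure H"
    proof
      fix x
      assume x: "x \<in> K"
      show "x \<in> closure H"
        unfolding closure_iff_nhds_not_empty
      proof (intro allI impI)
        fix A V
        assume A: "V \<subseteq> A" "open V" "x \<in> V"
        show "H \<inter> A \<noteq> {}"
        proof (cases "V \<inter> K \<inter> C = {}")
          case True
          then have "x \<in> closure (U \<inter> K)"
            using x A by (auto simp: C_def)
          then have "V \<inter> (U \<inter> K) \<noteq> {}"
            using A closure_iff_nhds_not_empty by blast
          then have "(V \<inter> U) \<inter> G \<noteq> {}"
            using dense[OF G(1), of "V \<inter> U"] A U by auto
          then show ?thesis
            using A G by blast
        next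
          case False
          then show ?thesis
            using A G by blast
        qed
      qed
    qed
    ultimately show "openin (top_of_set K) H \<and>
        top_of_set K closure_of H = topspace (top_of_set K)"
      using openin_imp_subset[of euclidean K H]
      by (auto simp: closure_of_subtopology Int_absorb1)
  qed
  then have "K \<subseteq> closure (K \<inter> \<Inter>\<H>)"
    by (auto simp: closure_of_subtopology)
  moreover obtain x where "x \<in> U" "x \<in> K"
    using U by auto
  ultimately have "U \<inter> (K \<inter> \<Inter>\<H>) \<noteq> {}"
    using open_Int_closure_eq_empty[OF U(1), of "K \<inter> \<Inter>\<H>"] by auto
  then obtain y where y: "y \<in> U" "y \<in> K" "y \<in> \<Inter>\<H>"
    by auto
  have "y \<notin> C"
    using y closure_subset[of "U \<inter> K"] by (auto simp: C_def)
  then have "y \<in> G" if "G \<in> \<G>" for G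
    using y that by (auto simp: \<H>_def)
  then show thesis
    using that y by blast
qed

text \<open>
  As in Mycielski's theorem, the points of \<open>U \<inter> K\<close> whose sections of all the relations
  are dense form a comeagre set, and no countable clique inside that set is maximal.
\<close>

lemma uncountable_clique:
  fixes K :: "'a::metric_space set"
  assumes K: "compact K" and U: "open U" "U \<inter> K \<noteq> {}"
    and perfect: "\<And>V. open V \<Longrightarrow> V \<inter> K \<noteq> {} \<Longrightarrow> infinite (V \<inter> K)"
    and count: "countable \<G>"
    and op: "\<And>G. G \<in> \<G> \<Longrightarrow> openin (top_of_set (K \<times> K)) G"
    and sym: "\<And>G x y. G \<in> \<G> \<Longrightarrow> (x, y) \<in> G \<Longrightarrow> (y, x) \<in> G"
    and dense: "\<And>G V W. G \<in> \<G> \<Longrightarrow> open V \<Longrightarrow> open W \<Longrightarrow> V \<subseteq> U \<Longrightarrow> W \<subseteq> U \<Longrightarrow>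
      V \<inter> K \<noteq> {} \<Longrightarrow> W \<inter> K \<noteq> {} \<Longrightarrow> (V \<times> W) \<inter> G \<noteq> {}"
  obtains S where "S \<subseteq> U \<inter> K" "uncountable S"
    "\<And>x y G. x \<in> S \<Longrightarrow> y \<in> S \<Longrightarrow> x \<noteq> y \<Longrightarrow> G \<in> \<G> \<Longrightarrow> (x, y) \<in> G"
proof -
  obtain \<B> where B: "countable \<B>" "\<And>B. B \<in> \<B> \<Longrightarrow> open B"
    "\<And>V p. open V \<Longrightarrow> p \<in> K \<Longrightarrow> p \<in> V \<Longrightarrow> \<exists>B\<in>\<B>. p \<in> B \<and> closure B \<subseteq> V"
    using compact_countable_base[OF K] by blast
  define \<B>' where "\<B>' = {B \<in> \<B>. B \<inter> U \<inter> K \<noteq> {}}"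
  \<comment> \<open>Membership of x in \<open>N G B\<close> for all B in \<open>\<B>'\<close> says
    that the section of G at x is dense in U \<inter> K.\<close>
  define N where "N G B = {x \<in> K. \<exists>y\<in>B \<inter> U \<inter> K. (x, y) \<in> G}" for G B
  have N_open: "openin (top_of_set K) (N G B)" if G: "G \<in> \<G>" "B \<in> \<B>'" for G B
  proof -
    obtain G' where G': "open G'" "G = (K \<times> K) \<inter> G'"
      using op[OF G(1)] by (auto simp: openin_open)
    have "N G B = K \<inter> (\<Union>y\<in>B \<inter> U \<inter> K. (\<lambda>x. (x, y)) -` G')"
      by (auto simp: N_def G'(2))
    moreover have "open (\<Union>y\<in>B \<inter> U \<inter> K. (\<lambda>x. (x, y)) -` G')"
      using G'(1) by (intro open_UN ballI open_vimage continuous_intros)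
    ultimately show ?thesis
      by (simp add: openin_open_Int)
  qed
  have N_dense: "V \<inter> N G B \<noteq> {}"
    if "G \<in> \<G>" "B \<in> \<B>'" "open V" "V \<subseteq> U" "V \<inter> K \<noteq> {}" for G B V
  proof -
    have "(V \<times> (B \<inter> U)) \<inter> G \<noteq> {}"
      using dense[OF that(1,3), of "B \<inter> U"] that B(2) U by (auto simp: \<B>'_def)
    then show ?thesis
      using op[OF that(1)] openin_imp_subset by (fastforce simp: N_def)
  qed
  define K' where "K' = {x \<in> U \<inter> K. \<forall>G\<in>\<G>. \<forall>B\<in>\<B>'. x \<in> N G B}"
  define \<C> where "\<C> = {S. S \<subseteq> K' \<and> (\<forall>x\<in>S. \<forall>y\<in>S. x \<noteq> y \<longrightarrow> (\<forall>G\<in>\<G>. (x, y) \<in> G))}"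
  have "\<Union>\<D> \<in> \<C>" if "subset.chain \<C> \<D>" for \<D>
  proof -
    have ch: "\<D> \<subseteq> \<C>" "\<And>A B. A \<in> \<D> \<Longrightarrow> B \<in> \<D> \<Longrightarrow> A \<subseteq> B \<or> B \<subseteq> A"
      using that by (auto simp: subset_chain_def)
    have "(x, y) \<in> G"
      if xy: "x \<in> A" "A \<in> \<D>" "y \<in> B" "B \<in> \<D>" "x \<noteq> y" "G \<in> \<G>" for x y A B G
    proof -
      obtain D where "D \<in> \<D>" "x \<in> D" "y \<in> D"
        using ch(2)[OF xy(2,4)] xy by blast
      then show ?thesis
        using ch(1) xy by (auto simp: \<C>_def)
    qed
    moreover have "\<Union>\<D> \<subseteq> K'"
      using ch(1) by (auto simp: \<C>_def)
    ultimately show ?thesis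
      by (auto simp: \<C>_def)
  qed
  then obtain S where S: "S \<in> \<C>" "\<And>S'. S' \<in> \<C> \<Longrightarrow> S \<subseteq> S' \<Longrightarrow> S' = S"
    using subset_Zorn'[of \<C>] by blast
  have "uncountable S"
  proof
    assume cS: "countable S"
    \<comment> \<open>A point of U in all these sets belongs to \<open>K'\<close>, differs from
      every s in S and is related to it, so it extends the maximal clique. Countability of S makes
      Baire category applicable.\<close>
    define \<H> where "\<H> = (\<Union>G\<in>\<G>. N G ` \<B>') \<union> (\<lambda>s. K - {s}) ` S \<union>
      (\<Union>G\<in>\<G>. (\<lambda>s. {x \<in> K. (s, x) \<in> G}) ` S)"
    have "countable \<B>'"
      using B(1) by (simp add: \<B>'_def)
    then have "countable \<H>"
      using count cS by (auto simp: \<H>_def)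
    moreover have "openin (top_of_set K) H" if "H \<in> \<H>" for H
      using that unfolding \<H>_def
    proof (elim UnE UN_E imageE)
      fix G s
      assume G: "G \<in> \<G>" "H = {x \<in> K. (s, x) \<in> G}" "s \<in> S"
      obtain G' where G': "open G'" "G = (K \<times> K) \<inter> G'"
        using op[OF G(1)] by (auto simp: openin_open)
      have "s \<in> K"
        using S(1) G by (auto simp: \<C>_def K'_def)
      then have "H = K \<inter> (\<lambda>x. (s, x)) -` G'"
        by (auto simp: G(2) G'(2))
      moreover have "open ((\<lambda>x. (s, x)) -` G')"
        using G'(1) by (intro open_vimage continuous_intros)
      ultimately show ?thesis
        by (simp add: openin_open_Int)
    next
      fix s
      assume "H = K - {s}"
      then have "H = K \<inter> (- {s})"
        by auto
      moreover have "open (- {s})"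
        by (simp add: open_Compl)
      ultimately show ?thesis
        by (simp add: openin_open_Int)
    qed (auto simp: N_open)
    moreover have "V \<inter> H \<noteq> {}" if "H \<in> \<H>" and V: "open V" "V \<subseteq> U" "V \<inter> K \<noteq> {}" for H V
      using that(1) unfolding \<H>_def
    proof (elim UnE UN_E imageE)
      fix G s
      assume G: "G \<in> \<G>" "H = {x \<in> K. (s, x) \<in> G}" "s \<in> S"
      obtain p where p: "p \<in> V" "p \<in> K"
        using V by auto
      then obtain b where b: "b \<in> \<B>" "p \<in> b" "closure b \<subseteq> V"
        using B(3)[OF V(1)] by blast
      then have "b \<subseteq> V"
        using closure_subset by blast
      then have "b \<in> \<B>'"
        using b p V by (auto simp: \<B>'_def)
      \<comment> \<open>\<open>K'\<close> was chosen for this: the section of G at s meets every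
        basic set, in particular one inside V.\<close>
      then have "s \<in> N G b"
        using S(1) G by (auto simp: \<C>_def K'_def)
      then show ?thesis
        using \<open>b \<subseteq> V\<close> G by (auto simp: N_def)
    next
      fix s
      assume H: "H = K - {s}"
      have "\<not> V \<inter> K \<subseteq> {s}"
        using perfect[OF V(1,3)] finite_subset by blast
      then show ?thesis
        using H by auto
    qed (auto simp: N_dense V)
    ultimately obtain x where x: "x \<in> U \<inter> K" "\<And>H. H \<in> \<H> \<Longrightarrow> x \<in> H"
      using compact_Baire[OF K U, of \<H>] by metis
    have "x \<in> K'"
      using x(1) by (auto simp: K'_def intro!: x(2)) (auto simp: \<H>_def)
    moreover have "(s, x) \<in> G" "(x, s) \<in> G" if "G \<in> \<G>" "s \<in> S" for G s
    proof -
      have "{x \<in> K. (s, x) \<in> G} \<in> \<H>"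
        using that by (auto simp: \<H>_def)
      from x(2)[OF this] show "(s, x) \<in> G"
        by simp
      then show "(x, s) \<in> G"
        using sym that by blast
    qed
    ultimately have "insert x S \<in> \<C>"
      using S(1) by (auto simp: \<C>_def)
    then have "x \<in> S"
      using S(2) by blast
    then have "K - {x} \<in> \<H>"
      by (auto simp: \<H>_def)
    then show False
      using x(2) by blast
  qed
  show thesis
  proof (rule that[OF _ \<open>uncountable S\<close>])
    show "S \<subseteq> U \<inter> K"
      using S(1) by (auto simp: \<C>_def K'_def)
    show "(x, y) \<in> G" if "x \<in> S" "y \<in> S" "x \<noteq> y" "G \<in> \<G>" for x y G
      using S(1) that by (auto simp: \<C>_def)
  qed
qed

subsection \<open>Generic fibres of continuous maps\<close>

text \<open>Nowhere density of the trace of A on Y; A itself may leave Y.\<close>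

definition nowhere_dense_in :: "'a::topological_space set \<Rightarrow> 'a set \<Rightarrow> bool" where
  "nowhere_dense_in Y A \<longleftrightarrow>
    (\<forall>V. open V \<and> V \<inter> Y \<noteq> {} \<longrightarrow> (\<exists>W. open W \<and> W \<subseteq> V \<and> W \<inter> Y \<noteq> {} \<and> W \<inter> Y \<inter> A = {}))"

lemma residual_in_Diff_Union:
  assumes "countable \<A>" and nd: "\<And>A. A \<in> \<A> \<Longrightarrow> nowhere_dense_in Y A"
  shows "residual_in Y (Y - \<Union>\<A>)"
proof -
  \<comment> \<open>\<open>from_nat_into\<close> enumerates nonempty families; for an empty one the
    empty set is repeated.\<close>
  define D where "D n = (if \<A> = {} then {} else from_nat_into \<A> n)" for n
  \<comment> \<open>Only the trace on Y is closed off: outside Y the sets are unrestricted and could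
    accumulate on Y.\<close>
  define G where "G n = Y - closure (Y \<inter> D n)" for n
  have D: "nowhere_dense_in Y (D n)" for n
    using nd from_nat_into[of \<A> n] by (auto simp: nowhere_dense_in_def D_def)
  have "openin (top_of_set Y) (G n)" for n
    unfolding G_def by (metis Diff_eq closed_closure open_Compl openin_open_Int)
  moreover have "Y \<subseteq> closure (G n)" for n
  proof
    fix y
    assume y: "y \<in> Y"
    show "y \<in> closure (G n)"
      unfolding closure_iff_nhds_not_empty
    proof (intro allI impI)
      fix A V
      assume A: "V \<subseteq> A" "open V" "y \<in> V"
      then have "open V \<and> V \<inter> Y \<noteq> {}"
        using y by blast
      then obtain W where W: "open W" "W \<subseteq> V" "W \<inter> Y \<noteq> {}" "W \<inter> Y \<inter> D n = {}"
        using D[of n] unfolding nowhere_dense_in_def by metis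
      have "W \<inter> closure (Y \<inter> D n) = {}"
        using W(4) by (simp add: open_Int_closure_eq_empty[OF W(1)] Int_assoc)
      then show "G n \<inter> A \<noteq> {}"
        using W(2,3) A(1) unfolding G_def by blast
    qed
  qed
  moreover have "(\<Inter>n. G n) \<subseteq> Y - \<Union>\<A>"
  proof
    fix y
    assume y: "y \<in> (\<Inter>n. G n)"
    have "y \<notin> A" if A: "A \<in> \<A>" for A
    proof -
      obtain n where n: "D n = A"
        using from_nat_into_surj[OF assms(1) A] A unfolding D_def by (metis empty_iff)
      have "y \<in> G n"
        using y by auto
      then show ?thesis
        using n closure_subset[of "Y \<inter> A"] by (auto simp: G_def)
    qed
    then show "y \<in> Y - \<Union>\<A>"
      using y by (auto simp: G_def)
  qed
  ultimately show ?thesis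
    unfolding residual_in_def by blast
qed

text \<open>Openness of f at all points over y. The map itself need not be open, but by
  \<open>open_fiber_residual\<close> it has this property over generic y.\<close>

definition open_fiber :: "'e::topological_space set \<Rightarrow> 'y::topological_space set \<Rightarrow>
    ('e \<Rightarrow> 'y) \<Rightarrow> 'y \<Rightarrow> bool" where
  "open_fiber E Y f y \<longleftrightarrow>
    (\<forall>U. open U \<and> (\<exists>p\<in>E \<inter> U. f p = y) \<longrightarrow> (\<exists>V. open V \<and> y \<in> V \<and> V \<inter> Y \<subseteq> f ` (E \<inter> U)))"

lemma open_fiberD:
  assumes "open_fiber E Y f y" "open U" "p \<in> E" "p \<in> U" "f p = y"
  obtains V where "open V" "y \<in> V" "V \<inter> Y \<subseteq> f ` (E \<inter> U)"
  using assms unfolding open_fiber_def by blast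

text \<open>A closed set minus its interior is nowhere dense. The closed sets are images of closures
  of basic sets; off these countably many boundaries, an image that contains y is a neighbourhood of
  y in Y.\<close>

lemma open_fiber_residual:
  fixes E :: "'e::metric_space set" and Y :: "'y::metric_space set"
  assumes E: "compact E" and f: "continuous_on E f"
  obtains \<A> where "countable \<A>" "\<And>A. A \<in> \<A> \<Longrightarrow> nowhere_dense_in Y A"
    "\<And>y. y \<in> Y \<Longrightarrow> y \<notin> \<Union>\<A> \<Longrightarrow> open_fiber E Y f y"
proof -
  obtain \<B> where B: "countable \<B>" "\<And>B. B \<in> \<B> \<Longrightarrow> open B"
    "\<And>V p. open V \<Longrightarrow> p \<in> E \<Longrightarrow> p \<in> V \<Longrightarrow> \<exists>B\<in>\<B>. p \<in> B \<and> closure B \<subseteq> V"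
    using compact_countable_base[OF E] by blast
  define C where "C B = f ` (E \<inter> closure B)" for B
  have C: "closed (C B)" for B
    unfolding C_def using E f
    by (intro compact_imp_closed compact_continuous_image)
       (auto intro: continuous_on_subset compact_Int_closed)
  define N where "N B = {y \<in> C B. \<not> (\<exists>V. open V \<and> y \<in> V \<and> V \<inter> Y \<subseteq> C B)}" for B
  show thesis
  proof
    show "countable (N ` \<B>)"
      using B(1) by simp
    fix A
    assume "A \<in> N ` \<B>"
    then obtain B where A: "A = N B"
      by blast
    show "nowhere_dense_in Y A"
      unfolding nowhere_dense_in_def
    proof (intro allI impI)
      fix V
      assume V: "open V \<and> V \<inter> Y \<noteq> {}"
      show "\<exists>W. open W \<and> W \<subseteq> V \<and> W \<inter> Y \<noteq> {} \<and> W \<inter> Y \<inter> A = {}"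
      proof (cases "V \<inter> Y \<subseteq> C B")
        case True
        then show ?thesis
          using V by (intro exI[of _ V]) (auto simp: A N_def)
      next
        case False
        then show ?thesis
          using V C[of B] by (intro exI[of _ "V - C B"]) (auto simp: A N_def open_Diff)
      qed
    qed
  next
    fix y
    assume y: "y \<in> Y" "y \<notin> \<Union>(N ` \<B>)"
    show "open_fiber E Y f y"
      unfolding open_fiber_def
    proof (intro allI impI, elim conjE bexE)
      fix U p
      assume U: "open U" "p \<in> E \<inter> U" "f p = y"
      then obtain B where B: "B \<in> \<B>" "p \<in> B" "closure B \<subseteq> U"
        using B(3) by blast
      have "y \<in> C B"
        using U B closure_subset by (fastforce simp: C_def)
      then obtain V where "open V" "y \<in> V" "V \<inter> Y \<subseteq> C B"
        using y B by (auto simp: N_def)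
      then show "\<exists>V. open V \<and> y \<in> V \<and> V \<inter> Y \<subseteq> f ` (E \<inter> U)"
        using B by (intro exI[of _ V]) (auto simp: C_def)
    qed
  qed
qed

text \<open>A Kuratowski-Ulam statement: density in E descends to generic fibres, because at points
  over an \<open>open_fiber\<close> value the image of a relatively open set is a neighbourhood of
  that value. Density is required only near such points, which is what \<open>box_transitive\<close>
  offers.\<close>

lemma dense_in_generic_fiber:
  fixes E :: "'e::metric_space set" and Y :: "'y::metric_space set"
  assumes E: "compact E" and f: "continuous_on E f" "f ` E \<subseteq> Y" and count: "countable \<G>"
    and op: "\<And>G. G \<in> \<G> \<Longrightarrow> openin (top_of_set E) G"
    and dense: "\<And>G U p. G \<in> \<G> \<Longrightarrow> open U \<Longrightarrow> p \<in> E \<Longrightarrow> p \<in> U \<Longrightarrow> open_fiber E Y f (f p) \<Longrightarrow>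
      \<exists>q\<in>U \<inter> G. open_fiber E Y f (f q)"
  obtains R where "residual_in Y R" "\<And>y. y \<in> R \<Longrightarrow> open_fiber E Y f y"
    "\<And>y G U p. y \<in> R \<Longrightarrow> G \<in> \<G> \<Longrightarrow> open U \<Longrightarrow> p \<in> E \<Longrightarrow> p \<in> U \<Longrightarrow> f p = y \<Longrightarrow>
      \<exists>q\<in>U \<inter> G. f q = y"
proof -
  obtain \<B> where B: "countable \<B>" "\<And>B. B \<in> \<B> \<Longrightarrow> open B"
    "\<And>V p. open V \<Longrightarrow> p \<in> E \<Longrightarrow> p \<in> V \<Longrightarrow> \<exists>B\<in>\<B>. p \<in> B \<and> closure B \<subseteq> V"
    using compact_countable_base[OF E] by blast
  obtain \<A> where A: "countable \<A>" "\<And>A. A \<in> \<A> \<Longrightarrow> nowhere_dense_in Y A"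
    "\<And>y. y \<in> Y \<Longrightarrow> y \<notin> \<Union>\<A> \<Longrightarrow> open_fiber E Y f y"
    using open_fiber_residual[OF E f(1)] by blast
  define N where "N B G = {y \<in> Y. open_fiber E Y f y \<and> (\<exists>p\<in>E \<inter> B. f p = y) \<and>
    (\<forall>p\<in>B \<inter> G. f p \<noteq> y)}" for B G
  have "nowhere_dense_in Y (N B G)" if BG: "B \<in> \<B>" "G \<in> \<G>" for B G
    unfolding nowhere_dense_in_def
  proof (intro allI impI)
    fix V
    assume V: "open V \<and> V \<inter> Y \<noteq> {}"
    show "\<exists>W. open W \<and> W \<subseteq> V \<and> W \<inter> Y \<noteq> {} \<and> W \<inter> Y \<inter> N B G = {}"
    proof (cases "V \<inter> N B G = {}")
      case True
      then show ?thesis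
        using V by (intro exI[of _ V]) auto
    next
      case False
      then obtain p where p: "f p \<in> V" "open_fiber E Y f (f p)" "p \<in> E" "p \<in> B"
        by (auto simp: N_def)
      obtain U where U: "open U" "U \<inter> E = f -` V \<inter> E"
        using f(1) V unfolding continuous_on_open_invariant by metis
      have "p \<in> B \<inter> U"
        using p U by blast
      moreover have "open (B \<inter> U)"
        using U B(2) BG by auto
      ultimately obtain q where q: "q \<in> B \<inter> U \<inter> G" "open_fiber E Y f (f q)"
        using dense[OF BG(2) _ p(3) _ p(2)] by blast
      obtain G' where G': "open G'" "G = E \<inter> G'"
        using op[OF BG(2)] by (auto simp: openin_open)
      have "open (B \<inter> G')" "q \<in> E" "q \<in> B \<inter> G'" "f q \<in> V"
        using G' B(2) BG q U by auto
      then obtain W where W: "open W" "f q \<in> W" "W \<inter> Y \<subseteq> f ` (E \<inter> (B \<inter> G'))"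
        using open_fiberD[OF q(2)] by metis
      \<comment> \<open>Openness at q spreads the good point q of B \<inter> G over a whole
        neighbourhood W of its base point.\<close>
      have "W \<inter> Y \<inter> N B G = {}"
        using W(3) G' unfolding N_def by fastforce
      then show ?thesis
        using W V q(1) G' f(2) \<open>f q \<in> V\<close> by (intro exI[of _ "W \<inter> V"]) auto
    qed
  qed
  then have nd: "nowhere_dense_in Y A" if "A \<in> \<A> \<union> (\<Union>B\<in>\<B>. N B ` \<G>)" for A
    using that A(2) by auto
  let ?R = "Y - \<Union>(\<A> \<union> (\<Union>B\<in>\<B>. N B ` \<G>))"
  show thesis
  proof
    show "residual_in Y ?R"
      using A(1) B(1) count nd by (intro residual_in_Diff_Union) auto
    show R: "open_fiber E Y f y" if "y \<in> ?R" for y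
      using that A(3) by blast
    show "\<exists>q\<in>U \<inter> G. f q = y"
      if y: "y \<in> ?R" and *: "G \<in> \<G>" "open U" "p \<in> E" "p \<in> U" "f p = y" for y G U p
    proof -
      obtain b where b: "b \<in> \<B>" "p \<in> b" "closure b \<subseteq> U"
        using B(3)[OF *(2-4)] by blast
      have "y \<notin> N b G" "y \<in> Y"
        using y b *(1) by blast+
      then obtain q where "q \<in> b \<inter> G" "f q = y"
        using *(3,5) b(2) R[OF y] unfolding N_def by blast
      then show ?thesis
        using b(3) closure_subset by blast
    qed
  qed
qed

subsection \<open>Orbit closures and minimal points\<close>

text \<open>Pointwise laws instead of a homomorphism into \<open>BijGroup\<close>: they are easy to
  check for powers, so that X, Y and all powers of X become instances.\<close>

locale compact_action = group T for T :: "('t, 'r) monoid_scheme" (structure) +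
  fixes Z :: "'z::metric_space set" and a :: "'t \<Rightarrow> 'z \<Rightarrow> 'z"
  assumes compact_phase: "compact Z"
    and act_closed: "t \<in> carrier T \<Longrightarrow> z \<in> Z \<Longrightarrow> a t z \<in> Z"
    and act_one: "z \<in> Z \<Longrightarrow> a \<one> z = z"
    and act_mult: "s \<in> carrier T \<Longrightarrow> t \<in> carrier T \<Longrightarrow> z \<in> Z \<Longrightarrow> a (s \<otimes> t) z = a s (a t z)"
    and act_cont: "t \<in> carrier T \<Longrightarrow> continuous_on Z (a t)"

lemma mem_orbit_closure_iff:
  "w \<in> orbit_closure T a z \<longleftrightarrow> (\<forall>U. open U \<and> w \<in> U \<longrightarrow> (\<exists>t\<in>carrier T. a t z \<in> U))"
  unfolding orbit_closure_def closure_iff_nhds_not_empty orbit_def by blast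

text \<open>Amounts to all points of the orbit closure having the same orbit closure, that is to
  minimality, without the restricted action of \<open>minimal_point\<close>.\<close>

definition orbit_minimal ::
  "('t, 'r) monoid_scheme \<Rightarrow> ('t \<Rightarrow> 'z \<Rightarrow> 'z) \<Rightarrow> 'z::metric_space \<Rightarrow> bool" where
  "orbit_minimal T a z \<longleftrightarrow> (\<forall>w\<in>orbit_closure T a z. z \<in> orbit_closure T a w)"

context compact_action
begin

lemma closed_phase: "closed Z"
  using compact_phase compact_imp_closed by blast

lemma act_inv: "t \<in> carrier T \<Longrightarrow> z \<in> Z \<Longrightarrow> a (inv t) (a t z) = z"
  by (metis act_mult act_one inv_closed l_inv)

lemma act_inv': "t \<in> carrier T \<Longrightarrow> z \<in> Z \<Longrightarrow> a t (a (inv t) z) = z"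
  by (metis act_mult act_one inv_closed r_inv)

lemma orbit_subset_invariant:
  assumes "z \<in> C" "\<And>t w. t \<in> carrier T \<Longrightarrow> w \<in> C \<Longrightarrow> a t w \<in> C"
  shows "orbit T a z \<subseteq> C"
  using assms by (auto simp: orbit_def)

lemma orbit_closure_subset_invariant:
  assumes "closed C" "z \<in> C" "\<And>t w. t \<in> carrier T \<Longrightarrow> w \<in> C \<Longrightarrow> a t w \<in> C"
  shows "orbit_closure T a z \<subseteq> C"
  unfolding orbit_closure_def using assms by (intro closure_minimal orbit_subset_invariant)

lemma orbit_closure_subset: "z \<in> Z \<Longrightarrow> orbit_closure T a z \<subseteq> Z"
  by (intro orbit_closure_subset_invariant closed_phase act_closed)

lemma orbit_closure_self: "z \<in> Z \<Longrightarrow> z \<in> orbit_closure T a z"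
  unfolding mem_orbit_closure_iff using act_one one_closed by metis

lemma compact_orbit_closure: "z \<in> Z \<Longrightarrow> compact (orbit_closure T a z)"
  by (metis closed_closure compact_Int_closed compact_phase inf.absorb_iff2 orbit_closure_def
      orbit_closure_subset)

lemma orbit_closure_act:
  assumes z: "z \<in> Z" and w: "w \<in> orbit_closure T a z" and t: "t \<in> carrier T"
  shows "a t w \<in> orbit_closure T a z"
  unfolding mem_orbit_closure_iff
proof (intro allI impI)
  fix U
  assume U: "open U \<and> a t w \<in> U"
  have "w \<in> Z"
    using z w orbit_closure_subset by blast
  obtain V where V: "open V" "V \<inter> Z = a t -` U \<inter> Z"
    using act_cont[OF t] U unfolding continuous_on_open_invariant by metis
  then have "w \<in> V"
    using U \<open>w \<in> Z\<close> by blast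
  then obtain s where s: "s \<in> carrier T" "a s z \<in> V"
    using w V(1) unfolding mem_orbit_closure_iff by blast
  then have "a t (a s z) \<in> U"
    using V(2) act_closed[OF s(1) z] by blast
  then show "\<exists>t\<in>carrier T. a t z \<in> U"
    using act_mult[OF t s(1) z] s t by (intro bexI[of _ "t \<otimes> s"]) auto
qed

lemma orbit_closure_mono:
  assumes "z \<in> Z" "w \<in> orbit_closure T a z"
  shows "orbit_closure T a w \<subseteq> orbit_closure T a z"
proof (rule orbit_closure_subset_invariant)
  show "closed (orbit_closure T a z)"
    by (simp add: orbit_closure_def)
qed (use assms orbit_closure_act in auto)

lemma orbit_minimal_orbit_closure:
  assumes "z \<in> Z" "orbit_minimal T a z" "w \<in> orbit_closure T a z"
  shows "orbit_minimal T a w"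
  unfolding orbit_minimal_def
proof
  fix u
  assume "u \<in> orbit_closure T a w"
  then have u: "u \<in> orbit_closure T a z"
    using orbit_closure_mono assms(1,3) by blast
  then have "u \<in> Z" "z \<in> orbit_closure T a u"
    using assms(1,2) orbit_closure_subset by (auto simp: orbit_minimal_def)
  then show "w \<in> orbit_closure T a u"
    using orbit_closure_mono assms(3) by blast
qed

lemma ex_orbit_minimal:
  assumes z: "z \<in> Z"
  obtains w where "w \<in> orbit_closure T a z" "orbit_minimal T a w"
proof -
  define \<F> where "\<F> = {C. closed C \<and> C \<noteq> {} \<and> C \<subseteq> orbit_closure T a z \<and>
    (\<forall>t\<in>carrier T. \<forall>w\<in>C. a t w \<in> C)}"
  have oc: "orbit_closure T a w \<in> \<F>" if "w \<in> orbit_closure T a z" for w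
  proof -
    have "w \<in> Z"
      using that orbit_closure_subset[OF z] by blast
    then show ?thesis
      using orbit_closure_self[of w] orbit_closure_act[of w] orbit_closure_mono[OF z that]
      by (auto simp: \<F>_def orbit_closure_def)
  qed
  \<comment> \<open>Zorn's lemma provides maximal sets, so it is applied to complements of closed
    invariant sets; the intersection of a chain of these is nonempty by compactness.\<close>
  have "\<exists>D\<in>uminus ` \<F>. \<forall>C\<in>\<C>. C \<subseteq> D" if ch: "subset.chain (uminus ` \<F>) \<C>" for \<C>
  proof (cases "\<C> = {}")
    case True
    then show ?thesis
      using oc[OF orbit_closure_self[OF z]] by blast
  next
    case False
    define \<D> where "\<D> = uminus ` \<C>"
    have \<D>: "\<D> \<subseteq> \<F>" "\<D> \<noteq> {}" "\<And>A B. A \<in> \<D> \<Longrightarrow> B \<in> \<D> \<Longrightarrow> A \<subseteq> B \<or> B \<subseteq> A"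
      using ch False by (auto simp: \<D>_def subset_chain_def)
    have fin: "\<Inter>\<E> \<in> \<D>" if "finite \<E>" "\<E> \<noteq> {}" "\<E> \<subseteq> \<D>" for \<E>
      using that
    proof (induction rule: finite_ne_induct)
      case (insert A \<E>)
      then have "A \<inter> \<Inter>\<E> = A \<or> A \<inter> \<Inter>\<E> = \<Inter>\<E>"
        using \<D>(3)[of A "\<Inter>\<E>"] by auto
      then show ?case
        using insert by auto
    qed auto
    have "orbit_closure T a z \<inter> \<Inter>\<D> \<noteq> {}"
    proof (rule compact_imp_fip[OF compact_orbit_closure[OF z]])
      show "closed A" if "A \<in> \<D>" for A
        using that \<D>(1) by (auto simp: \<F>_def)
      show "orbit_closure T a z \<inter> \<Inter>\<E> \<noteq> {}" if "finite \<E>" "\<E> \<subseteq> \<D>" for \<E>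
      proof (cases "\<E> = {}")
        case True
        then show ?thesis
          using orbit_closure_self[OF z] by auto
      next
        case False
        then have "\<Inter>\<E> \<in> \<F>"
          using fin that \<D>(1) by blast
        then show ?thesis
          by (auto simp: \<F>_def)
      qed
    qed
    moreover have "closed (\<Inter>\<D>)"
      using \<D>(1) by (intro closed_Inter) (auto simp: \<F>_def)
    moreover have "\<Inter>\<D> \<subseteq> orbit_closure T a z"
      using \<D>(1,2) by (auto simp: \<F>_def)
    moreover have "a t w \<in> \<Inter>\<D>" if "t \<in> carrier T" "w \<in> \<Inter>\<D>" for t w
      using that \<D>(1) by (auto simp: \<F>_def)
    ultimately have "\<Inter>\<D> \<in> \<F>"
      unfolding \<F>_def by blast
    moreover have "C \<subseteq> - \<Inter>\<D>" if "C \<in> \<C>" for C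
      using that unfolding \<D>_def by blast
    ultimately show ?thesis
      by blast
  qed
  then obtain D where D: "D \<in> uminus ` \<F>" "\<And>C. C \<in> uminus ` \<F> \<Longrightarrow> D \<subseteq> C \<Longrightarrow> C = D"
    using subset_Zorn[of "uminus ` \<F>"] by metis
  then have C: "- D \<in> \<F>"
    by auto
  have C_min: "B = - D" if "B \<in> \<F>" "B \<subseteq> - D" for B
  proof -
    have "D \<subseteq> - B"
      using that(2) by blast
    then show ?thesis
      using D(2)[of "- B"] that(1) by blast
  qed
  obtain w where w: "w \<in> - D" "w \<in> orbit_closure T a z"
    using C unfolding \<F>_def by blast
  have eq: "orbit_closure T a u = - D" if u: "u \<in> - D" for u
  proof (rule C_min)
    show "orbit_closure T a u \<in> \<F>"
      using C u by (intro oc) (auto simp: \<F>_def)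
    show "orbit_closure T a u \<subseteq> - D"
      using C u by (intro orbit_closure_subset_invariant) (auto simp: \<F>_def)
  qed
  then have "orbit_minimal T a w"
    unfolding orbit_minimal_def using w by blast
  then show thesis
    using that w by blast
qed

lemma orbit_minimal_imp_minimal_point:
  assumes z: "z \<in> Z" and min: "orbit_minimal T a z"
  shows "minimal_point T a z"
proof -
  define C where "C = orbit_closure T a z"
  define b where "b = (\<lambda>t. restrict (a t) C)"
  have C: "compact C" "C \<subseteq> Z" "\<And>t w. t \<in> carrier T \<Longrightarrow> w \<in> C \<Longrightarrow> a t w \<in> C"
    using z by (simp_all add: C_def compact_orbit_closure orbit_closure_subset orbit_closure_act)
  have bij: "b t \<in> Bij C" if t: "t \<in> carrier T" for t
  proof -
    have "bij_betw (a t) C C"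
      by (rule bij_betwI[of _ _ _ "a (inv t)"])
         (use C t act_inv act_inv' in \<open>auto simp: subset_iff\<close>)
    then show ?thesis
      by (auto simp: Bij_def b_def bij_betw_restrict_eq)
  qed
  have "group_action T C b"
    unfolding group_action_def group_hom_def group_hom_axioms_def hom_def
  proof (intro conjI CollectI ballI)
    show "group T" "group (BijGroup C)"
      by (simp_all add: group_BijGroup group_axioms)
    show "b \<in> carrier T \<rightarrow> carrier (BijGroup C)"
      using bij by (auto simp: BijGroup_def)
    show "b (s \<otimes> t) = b s \<otimes>\<^bsub>BijGroup C\<^esub> b t" if "s \<in> carrier T" "t \<in> carrier T" for s t
      using bij[OF that(1)] bij[OF that(2)] that C(2,3) act_mult
      by (auto simp: BijGroup_def b_def compose_def fun_eq_iff restrict_def subset_iff)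
  qed
  moreover have "continuous_on C (b t)" if "t \<in> carrier T" for t
    using continuous_on_subset[OF act_cont[OF that] C(2)]
    by (rule continuous_on_eq) (simp add: b_def)
  moreover have "closure (orbit T b x) = C" if "x \<in> C" for x
  proof -
    have "orbit T b x = orbit T a x"
      using that by (auto simp: orbit_def b_def)
    moreover have "orbit_closure T a x = C"
      using that min orbit_closure_mono z C(2) unfolding C_def orbit_minimal_def by blast
    ultimately show ?thesis
      by (simp add: orbit_closure_def)
  qed
  ultimately have "minimal_flow T C b"
    using C(1) by (simp add: minimal_flow_def flow_def)
  then show ?thesis
    by (simp add: minimal_point_def C_def b_def)
qed

text \<open>Continuity alone gives one inclusion; for the other, the image of a compact orbit
  closure is closed.\<close>

lemma orbit_closure_image:
  fixes h :: "'z \<Rightarrow> 'w::metric_space"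
  assumes h: "continuous_on Z h"
    and eqv: "\<And>t z. t \<in> carrier T \<Longrightarrow> z \<in> Z \<Longrightarrow> h (a t z) = b t (h z)"
    and u: "u \<in> Z"
  shows "orbit_closure T b (h u) = h ` orbit_closure T a u"
proof
  have hc: "continuous_on (orbit_closure T a u) h"
    using continuous_on_subset[OF h] orbit_closure_subset[OF u] by blast
  have orb: "h ` orbit T a u = orbit T b (h u)"
    using u eqv unfolding orbit_def by force
  have "h ` orbit T a u \<subseteq> h ` orbit_closure T a u"
    unfolding orbit_closure_def using closure_subset by blast
  moreover have "closed (h ` orbit_closure T a u)"
    by (intro compact_imp_closed compact_continuous_image hc compact_orbit_closure u)
  ultimately show "orbit_closure T b (h u) \<subseteq> h ` orbit_closure T a u"
    unfolding orbit_closure_def[of T b] orb[symmetric] by (rule closure_minimal)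
  show "h ` orbit_closure T a u \<subseteq> orbit_closure T b (h u)"
    unfolding orbit_closure_def orb[symmetric]
    by (rule continuous_image_closure_subset[OF hc[unfolded orbit_closure_def] order_refl])
qed

lemma orbit_minimal_image:
  fixes h :: "'z \<Rightarrow> 'w::metric_space"
  assumes h: "continuous_on Z h"
    and eqv: "\<And>t z. t \<in> carrier T \<Longrightarrow> z \<in> Z \<Longrightarrow> h (a t z) = b t (h z)"
    and z: "z \<in> Z" "orbit_minimal T a z"
  shows "orbit_minimal T b (h z)"
  unfolding orbit_minimal_def
proof
  have image: "orbit_closure T b (h u) = h ` orbit_closure T a u" if "u \<in> Z" for u
    using orbit_closure_image[of h b] h eqv that by blast
  fix w
  assume "w \<in> orbit_closure T b (h z)"
  then obtain v where v: "w = h v" "v \<in> orbit_closure T a z"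
    using image z by blast
  then have "z \<in> orbit_closure T a v" "v \<in> Z"
    using z orbit_closure_subset unfolding orbit_minimal_def by blast+
  then show "h z \<in> orbit_closure T b w"
    using image v by blast
qed

end

lemma flow_compact_action:
  assumes "flow T X \<phi>"
  shows "compact_action T X \<phi>"
proof -
  interpret group_action T X \<phi>
    using assms by (simp add: flow_def)
  have "group T"
    using group_hom group_hom.axioms(1) by blast
  then interpret group T .
  show ?thesis
  proof
    show "compact X" "\<And>t. t \<in> carrier T \<Longrightarrow> continuous_on X (\<phi> t)"
      using assms by (auto simp: flow_def)
    show "\<phi> t z \<in> X" if "t \<in> carrier T" "z \<in> X" for t z
      using element_image[OF that] by simp
    show "\<phi> \<one>\<^bsub>T\<^esub> z = z" if "z \<in> X" for z
      using that by (metis id_eq_one restrict_apply')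
    show "\<phi> (s \<otimes>\<^bsub>T\<^esub> t) z = \<phi> s (\<phi> t z)" if "s \<in> carrier T" "t \<in> carrier T" "z \<in> X" for s t z
      using composition_rule[OF that(3,1,2)] .
  qed
qed

subsection \<open>Powers\<close>

text \<open>Written as a product over all of nat, with singleton factors from n on, the power falls
  under Tychonoff's theorem for the topology of the function type.\<close>

lemma power_space_PiE_UNIV:
  "power_space X n = (\<Pi>\<^sub>E i\<in>UNIV. if i < n then X else {undefined})"
proof (rule equalityI; rule subsetI)
  fix x
  assume "x \<in> power_space X n"
  then show "x \<in> (\<Pi>\<^sub>E i\<in>UNIV. if i < n then X else {undefined})"
    unfolding power_space_def by (intro PiE_I) (auto dest: PiE_mem PiE_arb)
next
  fix x
  assume x: "x \<in> (\<Pi>\<^sub>E i\<in>UNIV. if i < n then X else {undefined})"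
  have "x i \<in> (if i < n then X else {undefined})" for i
    using PiE_mem[OF x, of i] by simp
  then show "x \<in> power_space X n"
    unfolding power_space_def by (intro PiE_I) (metis lessThan_iff singletonD)+
qed

lemma compact_power_space:
  assumes "compact (X :: 'x::metric_space set)"
  shows "compact (power_space X n)"
proof -
  have "compactin (product_topology (\<lambda>_::nat. euclidean) UNIV) (power_space X n)"
    unfolding power_space_PiE_UNIV by (subst compactin_PiE, rule disjI2) (use assms in auto)
  then show ?thesis
    unfolding euclidean_product_topology by simp
qed

lemma open_coordinate_balls:
  "open {w :: nat \<Rightarrow> 'x::metric_space. \<forall>i<n. dist (w i) (z i) < e}"
proof -
  have *: "{w. \<forall>i<n. dist (w i) (z i) < e} = (\<Inter>i\<in>{..<n}. (\<lambda>w. w i) -` ball (z i) e)"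
    by (auto simp: dist_commute)
  show ?thesis
    unfolding *
    by (intro open_INT ballI finite_lessThan)
       (rule open_vimage[OF open_ball continuous_on_product_coordinates])
qed

lemma open_contains_coordinate_balls:
  fixes U :: "(nat \<Rightarrow> 'x::metric_space) set"
  assumes "open U" "z \<in> U" "z \<in> power_space X n"
  obtains e where "e > 0"
    "\<And>w. w \<in> power_space X n \<Longrightarrow> (\<And>i. i < n \<Longrightarrow> dist (w i) (z i) < e) \<Longrightarrow> w \<in> U"
proof -
  have "openin (product_topology (\<lambda>_::nat. euclidean :: 'x topology) UNIV) U"
    using assms(1) by (simp add: euclidean_product_topology)
  then obtain B where B: "z \<in> PiE UNIV B" "\<And>i. open (B i)" "PiE UNIV B \<subseteq> U"
    using product_topology_open_contains_basis[OF _ assms(2)] by force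
  have "\<exists>e>0. ball (z i) e \<subseteq> B i" for i
    using B(1,2) by (metis PiE_E UNIV_I open_contains_ball)
  then obtain f where f: "\<And>i. f i > 0" "\<And>i. ball (z i) (f i) \<subseteq> B i"
    by metis
  \<comment> \<open>Coordinates from n on are \<open>undefined\<close> in both points, so finitely
    many radii decide; the 1 serves the case n = 0.\<close>
  define e where "e = Min (insert 1 (f ` {..<n}))"
  show thesis
  proof
    show "e > 0"
      using f(1) by (auto simp: e_def)
    fix w
    assume w: "w \<in> power_space X n" "\<And>i. i < n \<Longrightarrow> dist (w i) (z i) < e"
    have "w i \<in> B i" for i
    proof (cases "i < n")
      case True
      then have "dist (z i) (w i) < f i"
        using w(2)[OF True] by (simp add: e_def dist_commute)
      then show ?thesis
        by (intro subsetD[OF f(2)]) simp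
    next
      case False
      then have "w i = z i"
        using w(1) assms(3) unfolding power_space_def by (metis PiE_arb lessThan_iff)
      then show ?thesis
        using B(1) by auto
    qed
    then show "w \<in> U"
      using B(3) by auto
  qed
qed

lemma power_action_apply:
  "x \<in> power_space X n \<Longrightarrow> i < n \<Longrightarrow> power_action X n \<phi> t x i = \<phi> t (x i)"
  by (simp add: power_action_def)

lemma power_space_nth: "x \<in> power_space X n \<Longrightarrow> i < n \<Longrightarrow> x i \<in> X"
  by (auto simp: power_space_def)

lemma power_space_eqI:
  "x \<in> power_space X n \<Longrightarrow> w \<in> power_space X n \<Longrightarrow> (\<And>i. i < n \<Longrightarrow> x i = w i) \<Longrightarrow> x = w"
  unfolding power_space_def by (rule PiE_ext) auto

lemma continuous_on_power_space_restrict: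
  assumes "\<And>i. i < n \<Longrightarrow> continuous_on S (\<lambda>p. f p i)"
  shows "continuous_on S (\<lambda>p. \<lambda>i\<in>{..<n::nat}. f p i)"
proof (rule continuous_on_coordinatewise_then_product)
  show "continuous_on S (\<lambda>p. (\<lambda>i\<in>{..<n}. f p i) i)" for i
    using assms by (cases "i < n") auto
qed

lemma (in compact_action) power_compact_action:
  "compact_action T (power_space Z n) (power_action Z n a)"
proof
  show "compact (power_space Z n)"
    by (rule compact_power_space[OF compact_phase])
  show closed: "power_action Z n a t z \<in> power_space Z n"
    if "t \<in> carrier T" "z \<in> power_space Z n" for t z
    using that act_closed by (auto simp: power_action_def power_space_def)
  show "power_action Z n a \<one> z = z" if "z \<in> power_space Z n" for z
    by (rule power_space_eqI[OF closed[OF one_closed that] that])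
       (use that in \<open>simp add: power_action_apply act_one power_space_nth\<close>)
  show "power_action Z n a (s \<otimes> t) z = power_action Z n a s (power_action Z n a t z)"
    if "s \<in> carrier T" "t \<in> carrier T" "z \<in> power_space Z n" for s t z
    by (rule power_space_eqI[of _ Z n])
       (use that in \<open>simp_all add: closed power_action_apply act_mult power_space_nth\<close>)
  show "continuous_on (power_space Z n) (power_action Z n a t)" if "t \<in> carrier T" for t
  proof -
    have "continuous_on (power_space Z n) (\<lambda>p. \<lambda>i\<in>{..<n}. a t (p i))"
    proof (rule continuous_on_power_space_restrict)
      fix i
      assume "i < n"
      then show "continuous_on (power_space Z n) (\<lambda>p. a t (p i))"
        by (intro continuous_on_compose2[OF act_cont[OF that]]
            continuous_on_subset[OF continuous_on_product_coordinates])
           (auto simp: power_space_def)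
    qed
    then show ?thesis
      by (rule continuous_on_eq) (simp add: power_action_def)
  qed
qed

lemma (in compact_action) mem_power_orbit_closure_iff:
  assumes z: "z \<in> power_space Z n"
  shows "w \<in> orbit_closure T (power_action Z n a) z \<longleftrightarrow>
    w \<in> power_space Z n \<and> (\<forall>e>0. \<exists>t\<in>carrier T. \<forall>i<n. dist (a t (z i)) (w i) < e)"
proof -
  interpret P: compact_action T "power_space Z n" "power_action Z n a"
    by (rule power_compact_action)
  show ?thesis
  proof (intro iffI conjI allI impI)
    assume w: "w \<in> orbit_closure T (power_action Z n a) z"
    then show "w \<in> power_space Z n"
      using P.orbit_closure_subset[OF z] by blast
    fix e :: real
    assume "e > 0"
    then obtain t where "t \<in> carrier T"
      "power_action Z n a t z \<in> {v. \<forall>i<n. dist (v i) (w i) < e}"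
      using w[unfolded mem_orbit_closure_iff, rule_format, OF conjI,
          OF open_coordinate_balls[of n w e]] by auto
    then show "\<exists>t\<in>carrier T. \<forall>i<n. dist (a t (z i)) (w i) < e"
      using z by (auto simp: power_action_apply)
  next
    assume w: "w \<in> power_space Z n \<and> (\<forall>e>0. \<exists>t\<in>carrier T. \<forall>i<n. dist (a t (z i)) (w i) < e)"
    show "w \<in> orbit_closure T (power_action Z n a) z"
      unfolding mem_orbit_closure_iff
    proof (intro allI impI)
      fix U
      assume "open U \<and> w \<in> U"
      then obtain e where e: "e > 0"
        "\<And>v. v \<in> power_space Z n \<Longrightarrow> (\<And>i. i < n \<Longrightarrow> dist (v i) (w i) < e) \<Longrightarrow> v \<in> U"
        using open_contains_coordinate_balls w by metis
      then obtain t where "t \<in> carrier T" "\<forall>i<n. dist (a t (z i)) (w i) < e"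
        using w by blast
      then show "\<exists>t\<in>carrier T. power_action Z n a t z \<in> U"
        using z by (intro bexI[of _ t] e(2) P.act_closed) (auto simp: power_action_apply)
    qed
  qed
qed

text \<open>As r may omit, reorder and repeat indices, this covers projections as well as tuples
  with repeated entries.\<close>

lemma (in compact_action) reindex_equivariant:
  assumes r: "\<And>i. i < n \<Longrightarrow> r i < m"
  shows "continuous_on (power_space Z m) (\<lambda>z. \<lambda>i\<in>{..<n}. z (r i))"
    and "z \<in> power_space Z m \<Longrightarrow> (\<lambda>i\<in>{..<n}. z (r i)) \<in> power_space Z n"
    and "t \<in> carrier T \<Longrightarrow> z \<in> power_space Z m \<Longrightarrow>
      (\<lambda>i\<in>{..<n}. power_action Z m a t z (r i)) = power_action Z n a t (\<lambda>i\<in>{..<n}. z (r i))"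
proof -
  show "continuous_on (power_space Z m) (\<lambda>z. \<lambda>i\<in>{..<n}. z (r i))"
    by (intro continuous_on_power_space_restrict
        continuous_on_subset[OF continuous_on_product_coordinates]) auto
  show img: "(\<lambda>i\<in>{..<n}. z (r i)) \<in> power_space Z n" if "z \<in> power_space Z m" for z
    using r that by (auto simp: power_space_def)
  show "(\<lambda>i\<in>{..<n}. power_action Z m a t z (r i)) = power_action Z n a t (\<lambda>i\<in>{..<n}. z (r i))"
    if "t \<in> carrier T" "z \<in> power_space Z m"
    using that r img[OF that(2)] by (auto simp: power_action_def restrict_def fun_eq_iff)
qed

lemma (in compact_action) orbit_minimal_reindex:
  assumes z: "z \<in> power_space Z m" "orbit_minimal T (power_action Z m a) z"
    and r: "\<And>i. i < n \<Longrightarrow> r i < m"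
  shows "orbit_minimal T (power_action Z n a) (\<lambda>i\<in>{..<n}. z (r i))"
  using compact_action.orbit_minimal_image[OF power_compact_action, of m "\<lambda>z. \<lambda>i\<in>{..<n}. z (r i)"]
    reindex_equivariant[of n r m] r z by blast

text \<open>A closed condition that holds along the orbit passes to its closure. It is used with f =
  \<pi>, to keep coordinates in one fibre, and with the identity, to keep equal coordinates
  equal.\<close>

lemma (in compact_action) power_orbit_closure_eq:
  fixes f :: "'z \<Rightarrow> 'w::metric_space"
  assumes f: "continuous_on Z f" and w: "w \<in> power_space Z n" "i < n" "j < n"
    and eq: "\<And>t. t \<in> carrier T \<Longrightarrow> f (a t (w i)) = f (a t (w j))"
    and v: "v \<in> orbit_closure T (power_action Z n a) w"
  shows "f (v i) = f (v j)"
proof -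
  interpret P: compact_action T "power_space Z n" "power_action Z n a"
    by (rule power_compact_action)
  have coord: "continuous_on (orbit_closure T (power_action Z n a) w) (\<lambda>v. f (v k))" if "k < n" for k
  proof (rule continuous_on_compose2[OF f])
    show "continuous_on (orbit_closure T (power_action Z n a) w) (\<lambda>v. v k)"
      by (rule continuous_on_subset[OF continuous_on_product_coordinates]) simp
    show "(\<lambda>v. v k) ` orbit_closure T (power_action Z n a) w \<subseteq> Z"
      using P.orbit_closure_subset[OF w(1)] that power_space_nth by blast
  qed
  have "dist (f (v i)) (f (v j)) = 0"
  proof (rule continuous_constant_on_closure[where f = "\<lambda>v. dist (f (v i)) (f (v j))"
        and S = "orbit T (power_action Z n a) w"])
    show "continuous_on (closure (orbit T (power_action Z n a) w)) (\<lambda>v. dist (f (v i)) (f (v j)))"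
      using continuous_on_dist[OF coord[OF w(2)] coord[OF w(3)]] by (simp add: orbit_closure_def)
    show "dist (f (u i)) (f (u j)) = 0" if "u \<in> orbit T (power_action Z n a) w" for u
      using that eq w by (auto simp: orbit_def power_action_apply)
    show "v \<in> closure (orbit T (power_action Z n a) w)"
      using v by (simp add: orbit_closure_def)
  qed
  then show ?thesis
    by simp
qed

text \<open>A tuple of coordinates of z is z reindexed, possibly with repetitions, so it inherits
  minimality.\<close>

lemma (in compact_action) almost_periodic_set_of_tuple:
  assumes z: "z \<in> power_space Z m" "orbit_minimal T (power_action Z m a) z"
  shows "almost_periodic_set T Z a (z ` {..<m})"
  unfolding almost_periodic_set_def
proof (intro conjI allI ballI)
  show "z ` {..<m} \<subseteq> Z"
    using z(1) by (auto simp: power_space_def)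
  fix n x
  assume x: "x \<in> power_space (z ` {..<m}) n"
  then have "\<forall>i\<in>{..<n}. \<exists>j<m. x i = z j"
    by (auto simp: power_space_def PiE_iff)
  then obtain r where r: "\<And>i. i < n \<Longrightarrow> r i < m" "\<And>i. i < n \<Longrightarrow> x i = z (r i)"
    by (metis lessThan_iff)
  have "x = (\<lambda>i\<in>{..<n}. z (r i))"
    by (rule power_space_eqI[OF x]) (use r in \<open>auto simp: power_space_def\<close>)
  moreover have "x \<in> power_space Z n"
    unfolding power_space_def
  proof (rule PiE_I)
    show "x i \<in> Z" if "i \<in> {..<n}" for i
      using that r power_space_nth[OF z(1)] by auto
    show "x i = undefined" if "i \<notin> {..<n}" for i
      using x that unfolding power_space_def by (rule PiE_arb)
  qed
  ultimately show "minimal_point T (power_action Z n a) x"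
    using orbit_minimal_reindex[OF z, of n r] r(1)
    by (intro compact_action.orbit_minimal_imp_minimal_point[OF power_compact_action]) simp_all
qed

subsection \<open>The relative product with a minimal flow of tuples\<close>

locale minimal_extension = compact_action T X \<phi>
  for T :: "('t, 'r) monoid_scheme" (structure)
    and X :: "'x::metric_space set" and \<phi> :: "'t \<Rightarrow> 'x \<Rightarrow> 'x" +
  fixes Y :: "'y::metric_space set" and \<psi> :: "'t \<Rightarrow> 'y \<Rightarrow> 'y" and \<pi> :: "'x \<Rightarrow> 'y"
  assumes base_action: "compact_action T Y \<psi>"
    and factor: "continuous_on X \<pi>" "\<And>x. x \<in> X \<Longrightarrow> \<pi> x \<in> Y"
      "\<And>t x. t \<in> carrier T \<Longrightarrow> x \<in> X \<Longrightarrow> \<pi> (\<phi> t x) = \<psi> t (\<pi> x)"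
    and onto: "\<And>y. y \<in> Y \<Longrightarrow> \<exists>x\<in>X. \<pi> x = y"
    and dense_orbits: "\<And>x. x \<in> X \<Longrightarrow> orbit_closure T \<phi> x = X"
begin

sublocale Y: compact_action T Y \<psi>
  by (rule base_action)

end

text \<open>What the density argument uses of the orbit closure M. \<open>collapse\<close> is the
  trace of the maximality of N, \<open>separated\<close> that of the distinctness of coordinates,
  made uniform by compactness; \<open>ex_tuple_extension\<close> provides an instance.\<close>

locale tuple_extension = minimal_extension T X \<phi> Y \<psi> \<pi>
  for T :: "('t, 'r) monoid_scheme" (structure)
    and X :: "'x::metric_space set" and \<phi> :: "'t \<Rightarrow> 'x \<Rightarrow> 'x"
    and Y :: "'y::metric_space set" and \<psi> :: "'t \<Rightarrow> 'y \<Rightarrow> 'y" and \<pi> :: "'x \<Rightarrow> 'y" +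
  fixes N :: nat and M :: "(nat \<Rightarrow> 'x) set" and \<delta> :: real
  assumes tuples: "0 < N" "M \<subseteq> power_space X N" "compact M"
      "\<And>t z. t \<in> carrier T \<Longrightarrow> z \<in> M \<Longrightarrow> power_action X N \<phi> t z \<in> M"
    and first_coordinate: "\<And>x. x \<in> X \<Longrightarrow> \<exists>z\<in>M. z 0 = x"
    and same_fiber: "\<And>z i. z \<in> M \<Longrightarrow> i < N \<Longrightarrow> \<pi> (z i) = \<pi> (z 0)"
    and separated: "0 < \<delta>"
      "\<And>z i j. z \<in> M \<Longrightarrow> i < N \<Longrightarrow> j < N \<Longrightarrow> i \<noteq> j \<Longrightarrow> \<delta> \<le> dist (z i) (z j)"
    and collapse: "\<And>z C e. z \<in> M \<Longrightarrow> finite C \<Longrightarrow> C \<subseteq> fiber X \<pi> (\<pi> (z 0)) \<Longrightarrow> 0 < e \<Longrightarrow>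
      \<exists>s\<in>carrier T. (\<forall>i<N. dist (\<phi> s (z i)) (z i) < e) \<and>
        (\<forall>c\<in>C. \<exists>i<N. dist (\<phi> s c) (z i) < e)"
begin

definition E :: "('x \<times> (nat \<Rightarrow> 'x)) set" where
  "E = {(x, z). x \<in> X \<and> z \<in> M \<and> \<pi> x = \<pi> (z 0)}"

definition proj :: "'x \<times> (nat \<Rightarrow> 'x) \<Rightarrow> 'y" where
  "proj p = \<pi> (fst p)"

text \<open>Defined on X x X^N because permuting a tuple may lead out of M. Permutations act on
  indices from the right, hence their reversed order in \<open>act_act\<close>.\<close>

definition act :: "'t \<Rightarrow> (nat \<Rightarrow> nat) \<Rightarrow> 'x \<times> (nat \<Rightarrow> 'x) \<Rightarrow> 'x \<times> (nat \<Rightarrow> 'x)" where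
  "act g \<sigma> p = (\<phi> g (fst p), \<lambda>i\<in>{..<N}. \<phi> g (snd p (\<sigma> i)))"

abbreviation open_at :: "'y \<Rightarrow> bool" where
  "open_at \<equiv> open_fiber E Y proj"

lemma tuple_nth: "z \<in> M \<Longrightarrow> i < N \<Longrightarrow> z i \<in> X"
  using tuples(2) power_space_nth by blast

lemma E_subset: "E \<subseteq> X \<times> power_space X N"
  using tuples(2) by (auto simp: E_def)

lemma compact_E: "compact E"
proof -
  have "continuous_on (X \<times> M) (\<lambda>p. \<pi> (fst p))"
    by (intro continuous_on_compose2[OF factor(1)] continuous_on_fst continuous_on_id) auto
  moreover have "continuous_on (X \<times> M) (\<lambda>p. \<pi> (snd p 0))"
    by (intro continuous_on_compose2[OF factor(1)] continuous_on_snd continuous_on_id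
        continuous_on_product_then_coordinatewise) (use tuple_nth tuples(1) in auto)
  ultimately have "continuous_on (X \<times> M) (\<lambda>p. dist (\<pi> (fst p)) (\<pi> (snd p 0)))"
    by (rule continuous_on_dist)
  then have "closedin (top_of_set (X \<times> M)) {p \<in> X \<times> M. dist (\<pi> (fst p)) (\<pi> (snd p 0)) = 0}"
    by (rule continuous_closedin_preimage_constant)
  moreover have "{p \<in> X \<times> M. dist (\<pi> (fst p)) (\<pi> (snd p 0)) = 0} = E"
    by (auto simp: E_def)
  ultimately show ?thesis
    using closedin_compact compact_Times compact_phase tuples(3) by metis
qed

lemma continuous_on_proj: "continuous_on E proj"
  unfolding proj_def
  by (intro continuous_on_compose2[OF factor(1)] continuous_on_fst continuous_on_id)
     (auto simp: E_def)

lemma proj_in: "p \<in> E \<Longrightarrow> proj p \<in> Y"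
  using factor(2)[of "fst p"] by (auto simp: E_def proj_def)

lemma continuous_on_act:
  assumes "g \<in> carrier T" "\<sigma> permutes {..<N}"
  shows "continuous_on (X \<times> power_space X N) (act g \<sigma>)"
  unfolding act_def
proof (intro continuous_on_Pair continuous_on_power_space_restrict)
  show "continuous_on (X \<times> power_space X N) (\<lambda>p. \<phi> g (fst p))"
    by (intro continuous_on_compose2[OF act_cont[OF assms(1)]] continuous_on_fst continuous_on_id)
       auto
  show "continuous_on (X \<times> power_space X N) (\<lambda>p. \<phi> g (snd p (\<sigma> i)))" if "i < N" for i
  proof (rule continuous_on_compose2[OF act_cont[OF assms(1)]])
    show "continuous_on (X \<times> power_space X N) (\<lambda>p. snd p (\<sigma> i))"
      by (rule continuous_on_product_then_coordinatewise) (intro continuous_on_snd continuous_on_id)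
    have "\<sigma> i < N"
      using permutes_in_image[OF assms(2), of i] that by simp
    then show "(\<lambda>p. snd p (\<sigma> i)) ` (X \<times> power_space X N) \<subseteq> X"
      using power_space_nth by force
  qed
qed

lemma act_in_power:
  assumes "g \<in> carrier T" "\<sigma> permutes {..<N}" "p \<in> X \<times> power_space X N"
  shows "act g \<sigma> p \<in> X \<times> power_space X N"
proof -
  have "\<phi> g (snd p (\<sigma> i)) \<in> X" if "i < N" for i
    using permutes_in_image[OF assms(2), of i] that assms(3) power_space_nth[of "snd p" X N "\<sigma> i"]
    by (intro act_closed[OF assms(1)]) (auto simp: mem_Times_iff)
  then show ?thesis
    using assms(3) act_closed[OF assms(1)] by (auto simp: act_def power_space_def)
qed

lemma act_vimage_open:
  assumes "g \<in> carrier T" "\<sigma> permutes {..<N}" "open U"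
  obtains W where "open W"
    "\<And>p. p \<in> X \<times> power_space X N \<Longrightarrow> p \<in> W \<longleftrightarrow> act g \<sigma> p \<in> U"
proof -
  obtain W where "open W" "W \<inter> (X \<times> power_space X N) = act g \<sigma> -` U \<inter> (X \<times> power_space X N)"
    using continuous_on_act[OF assms(1,2)] assms(3) unfolding continuous_on_open_invariant by metis
  then show thesis
    using that[of W] by blast
qed

lemma act_act:
  assumes "g \<in> carrier T" "h \<in> carrier T" "\<sigma> permutes {..<N}" "\<tau> permutes {..<N}"
    and p: "p \<in> X \<times> power_space X N"
  shows "act g \<sigma> (act h \<tau> p) = act (g \<otimes> h) (\<tau> \<circ> \<sigma>) p"
proof -
  have "\<phi> g (\<phi> h (fst p)) = \<phi> (g \<otimes> h) (fst p)"
    using p assms by (auto simp: act_mult)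
  moreover have "\<sigma> i < N" "\<phi> g (\<phi> h (snd p (\<tau> (\<sigma> i)))) = \<phi> (g \<otimes> h) (snd p (\<tau> (\<sigma> i)))"
    if "i < N" for i
  proof -
    show \<sigma>: "\<sigma> i < N"
      using permutes_in_image[OF assms(3), of i] that by simp
    then have "\<tau> (\<sigma> i) < N"
      using permutes_in_image[OF assms(4), of "\<sigma> i"] by simp
    then show "\<phi> g (\<phi> h (snd p (\<tau> (\<sigma> i)))) = \<phi> (g \<otimes> h) (snd p (\<tau> (\<sigma> i)))"
      using p assms power_space_nth[of "snd p" X N] by (auto simp: act_mult)
  qed
  ultimately show ?thesis
    by (auto simp: act_def restrict_def fun_eq_iff)
qed

lemma act_id: "z \<in> M \<Longrightarrow> act g id (x, z) = (\<phi> g x, power_action X N \<phi> g z)"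
  using tuples(2) by (auto simp: act_def power_action_def)

lemma act_id_in:
  assumes "p \<in> E" "g \<in> carrier T"
  shows "act g id p \<in> E" "proj (act g id p) = \<psi> g (proj p)"
  using assms tuples tuple_nth act_closed factor(3)
  by (auto simp: E_def act_id proj_def power_action_apply subset_iff)

text \<open>Translation by g is a homeomorphism of E over a homeomorphism of Y: openness at the
  inverse translate of p, which lies over y, is pushed forward by g.\<close>

lemma open_at_act:
  assumes y: "y \<in> Y" "open_at y" and g: "g \<in> carrier T"
  shows "open_at (\<psi> g y)"
  unfolding open_fiber_def
proof (intro allI impI, elim conjE bexE)
  fix U p
  assume U: "open U" "p \<in> E \<inter> U" "proj p = \<psi> g y"
  obtain W where W: "open W" "\<And>p. p \<in> X \<times> power_space X N \<Longrightarrow> p \<in> W \<longleftrightarrow> act g id p \<in> U"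
    using act_vimage_open[OF g permutes_id U(1)] by blast
  let ?q = "act (inv g) id p"
  have p: "p \<in> E" "p \<in> X \<times> power_space X N"
    using U E_subset by auto
  have q: "?q \<in> E" "proj ?q = y"
    using act_id_in[OF p(1) inv_closed[OF g]] U(3) Y.act_inv[OF g y(1)] by auto
  have "act g id ?q = act (g \<otimes> inv g) (id \<circ> id) p"
    by (rule act_act) (use g p permutes_id in auto)
  also have "\<dots> = p"
    using U(2) tuples(2) g act_one power_space_nth[of "snd p" X N]
    by (cases p) (auto simp: E_def act_def intro!: power_space_eqI[of _ X N] simp: power_space_def)
  finally have "?q \<in> W"
    using W(2)[of ?q] q(1) E_subset U(2) by auto
  then obtain V where V: "open V" "y \<in> V" "V \<inter> Y \<subseteq> proj ` (E \<inter> W)"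
    using open_fiberD[OF y(2) W(1) q(1) _ q(2)] by metis
  obtain V' where V': "open V'" "V' \<inter> Y = \<psi> (inv g) -` V \<inter> Y"
    using Y.act_cont[OF inv_closed[OF g]] V(1) unfolding continuous_on_open_invariant by metis
  have "\<psi> g y \<in> V'"
    using V' V(2) Y.act_inv[OF g y(1)] Y.act_closed[OF g y(1)] by auto
  moreover have "V' \<inter> Y \<subseteq> proj ` (E \<inter> U)"
  proof
    fix y'
    assume y': "y' \<in> V' \<inter> Y"
    then have "\<psi> (inv g) y' \<in> V \<inter> Y"
      using V' Y.act_closed inv_closed[OF g] by blast
    then have "\<psi> (inv g) y' \<in> proj ` (E \<inter> W)"
      using V(3) by blast
    then obtain r where r: "r \<in> E" "r \<in> W" "proj r = \<psi> (inv g) y'"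
      by force
    have "act g id r \<in> U"
      using W(2) r E_subset by blast
    moreover have "proj (act g id r) = y'"
      using act_id_in(2)[OF r(1) g] r(3) Y.act_inv'[OF g] y' by auto
    ultimately show "y' \<in> proj ` (E \<inter> U)"
      using act_id_in(1)[OF r(1) g] by blast
  qed
  ultimately show "\<exists>V. open V \<and> \<psi> g y \<in> V \<and> V \<inter> Y \<subseteq> proj ` (E \<inter> U)"
    using V'(1) by blast
qed

section \<open>Transitivity of the relative product under translations and permutations\<close>

lemma visit_cover:
  assumes A: "open A" "A \<inter> X \<noteq> {}"
  obtains F where "finite F" "F \<subseteq> carrier T" "\<And>x. x \<in> X \<Longrightarrow> \<exists>t\<in>F. \<phi> t x \<in> A"
proof -
  have "\<exists>W. open W \<and> W \<inter> X = \<phi> t -` A \<inter> X" if "t \<in> carrier T" for t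
    using act_cont[OF that] A(1) unfolding continuous_on_open_invariant by metis
  then obtain W where W: "\<And>t. t \<in> carrier T \<Longrightarrow> open (W t)"
    "\<And>t. t \<in> carrier T \<Longrightarrow> W t \<inter> X = \<phi> t -` A \<inter> X"
    by metis
  \<comment> \<open>All orbits are dense, so every point is brought into A by some t; compactness
    then leaves finitely many t, as \<open>box_transitive\<close> needs.\<close>
  have "X \<subseteq> (\<Union>t\<in>carrier T. W t)"
  proof
    fix x
    assume x: "x \<in> X"
    obtain a where a: "a \<in> A" "a \<in> orbit_closure T \<phi> x"
      using A(2) dense_orbits[OF x] by auto
    then obtain t where "t \<in> carrier T" "\<phi> t x \<in> A"
      using A(1) unfolding mem_orbit_closure_iff by blast
    then show "x \<in> (\<Union>t\<in>carrier T. W t)"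
      using W(2) x by blast
  qed
  then obtain F where F: "F \<subseteq> carrier T" "finite F" "X \<subseteq> (\<Union>t\<in>F. W t)"
    using compactE_image[OF compact_phase, of "carrier T" W] W(1) by metis
  have "\<exists>t\<in>F. \<phi> t x \<in> A" if "x \<in> X" for x
  proof -
    have "x \<in> (\<Union>t\<in>F. W t)"
      using F(3) that by auto
    then show ?thesis
      using W(2) F(1) that by blast
  qed
  then show thesis
    using that F by blast
qed

text \<open>
  A collapsing translation brings finitely many tuples over one base point close to a single tuple,
  up to the order of the coordinates. Applied to tuples which, with a finite cover of \<open>X\<close> by
  translates, spread over the whole fibre, it moves one point of the given box into the other.
\<close>

lemma box_transitive:
  assumes \<Omega>: "open \<Omega>" "p \<in> E" "p \<in> \<Omega>" "open_at (proj p)"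
    and U: "open U" "q \<in> E" "q \<in> U" "open_at (proj q)"
  obtains r g \<sigma> where "r \<in> E" "r \<in> \<Omega>" "open_at (proj r)" "g \<in> carrier T" "\<sigma> permutes {..<N}"
    "act g \<sigma> r \<in> U"
proof -
  obtain A B where AB: "open A" "open B" "p \<in> A \<times> B" "A \<times> B \<subseteq> \<Omega>"
    using open_prod_elim[OF \<Omega>(1,3)] by metis
  obtain O1 where O1: "open O1" "proj p \<in> O1" "O1 \<inter> Y \<subseteq> proj ` (E \<inter> (A \<times> B))"
    using open_fiberD[OF \<Omega>(4) open_Times[OF AB(1,2)] \<Omega>(2) AB(3) refl] by metis
  \<comment> \<open>Points of A1 lie over O1, so whenever t brings a point over y into A1, some
    tuple in B lies over \<psi> t y.\<close>
  obtain A1 where A1: "open A1" "A1 \<inter> X = \<pi> -` O1 \<inter> X"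
    using factor(1) O1(1) unfolding continuous_on_open_invariant by metis
  have "fst p \<in> X"
    using \<Omega>(2) by (auto simp: E_def)
  moreover have "fst p \<in> A1"
    using A1(2) O1(2) calculation by (auto simp: proj_def)
  ultimately have "(A \<inter> A1) \<inter> X \<noteq> {}"
    using AB(3) by auto
  then obtain F where F: "finite F" "F \<subseteq> carrier T"
    "\<And>x. x \<in> X \<Longrightarrow> \<exists>t\<in>F. \<phi> t x \<in> A \<inter> A1"
    using visit_cover[OF open_Int[OF AB(1) A1(1)]] by metis
  obtain x z where q: "q = (x, z)"
    by force
  obtain U1 V1 where UV: "open U1" "open V1" "q \<in> U1 \<times> V1" "U1 \<times> V1 \<subseteq> U"
    using open_prod_elim[OF U(1,3)] by metis
  have xz: "x \<in> X" "z \<in> M" "\<pi> x = \<pi> (z 0)" "z \<in> power_space X N"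
    using U(2) q tuples(2) by (auto simp: E_def)
  define y where "y = \<pi> x"
  have y: "y \<in> Y" "proj q = y"
    using factor(2)[OF xz(1)] q by (simp_all add: y_def proj_def)
  obtain O2 where O2: "open O2" "y \<in> O2" "O2 \<inter> Y \<subseteq> proj ` (E \<inter> (U1 \<times> V1))"
    using open_fiberD[OF U(4) open_Times[OF UV(1,2)] U(2) UV(3) refl] y(2) by metis
  obtain e1 where e1: "e1 > 0"
    "\<And>w. w \<in> power_space X N \<Longrightarrow> (\<And>i. i < N \<Longrightarrow> dist (w i) (z i) < e1) \<Longrightarrow> w \<in> V1"
    using open_contains_coordinate_balls[OF UV(2) _ xz(4)] UV(3) q by auto
  obtain A2 where A2: "open A2" "A2 \<inter> X = \<pi> -` O2 \<inter> X"
    using factor(1) O2(1) unfolding continuous_on_open_invariant by metis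
  have "z 0 \<in> A2"
    using A2(2) O2(2) xz tuple_nth[OF xz(2) tuples(1)] by (auto simp: y_def)
  then obtain e2 where e2: "e2 > 0" "ball (z 0) e2 \<subseteq> A2"
    using A2(1) openE by blast
  \<comment> \<open>e1 keeps tuples close to z in V1, e2 keeps the translated base point in O2, and
    \<delta> / 2 prevents two coordinates of a tuple in M from approaching the same coordinate of
    z.\<close>
  define e where "e = min (min e1 e2) (\<delta> / 2)"
  have e: "e > 0" "e \<le> e1" "e \<le> e2" "e \<le> \<delta> / 2"
    using e1 e2 separated(1) by (auto simp: e_def)
  \<comment> \<open>The t used in the end depends on a point that is known only after s is chosen.
    So a tuple \<open>b t\<close> is prepared for every t that may occur, and s collapses all of
    them at once.\<close>
  define F' where "F' = {t \<in> F. \<exists>x'\<in>X. \<pi> x' = y \<and> \<phi> t x' \<in> A \<inter> A1}"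
  have "\<exists>b. b \<in> M \<and> b \<in> B \<and> \<pi> (b 0) = \<psi> t y" if t: "t \<in> F'" for t
  proof -
    obtain x' where x': "x' \<in> X" "\<pi> x' = y" "\<phi> t x' \<in> A1" "t \<in> carrier T"
      using t F(2) by (auto simp: F'_def)
    then have "\<phi> t x' \<in> X" "\<pi> (\<phi> t x') = \<psi> t y"
      using act_closed factor(3) by auto
    moreover have "\<pi> (\<phi> t x') \<in> O1"
      using A1(2) x'(3) calculation(1) by blast
    ultimately have "\<psi> t y \<in> O1 \<inter> Y"
      using factor(2)[of "\<phi> t x'"] by simp
    then have "\<psi> t y \<in> proj ` (E \<inter> (A \<times> B))"
      using O1(3) by blast
    then obtain r where "r \<in> E" "r \<in> A \<times> B" "proj r = \<psi> t y"
      by force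
    then show ?thesis
      by (intro exI[of _ "snd r"]) (auto simp: E_def proj_def)
  qed
  then obtain b where b: "\<And>t. t \<in> F' \<Longrightarrow> b t \<in> M" "\<And>t. t \<in> F' \<Longrightarrow> b t \<in> B"
    "\<And>t. t \<in> F' \<Longrightarrow> \<pi> (b t 0) = \<psi> t y"
    by metis
  have F': "t \<in> carrier T" if "t \<in> F'" for t
    using that F(2) by (auto simp: F'_def)
  define C where "C = (\<Union>t\<in>F'. (\<lambda>i. \<phi> (inv t) (b t i)) ` {..<N})"
  have "finite C"
    using F(1) by (auto simp: C_def F'_def)
  moreover have "C \<subseteq> fiber X \<pi> (\<pi> (z 0))"
  proof
    fix c
    assume "c \<in> C"
    then obtain t i where t: "t \<in> F'" "i < N" "c = \<phi> (inv t) (b t i)"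
      by (auto simp: C_def)
    then have "\<pi> c = \<psi> (inv t) (\<psi> t y)"
      using b F' factor(3) tuple_nth same_fiber by (metis inv_closed)
    then show "c \<in> fiber X \<pi> (\<pi> (z 0))"
      using t b(1) F' act_closed tuple_nth Y.act_inv y(1) xz(3)
      by (auto simp: fiber_def y_def)
  qed
  ultimately obtain s where s: "s \<in> carrier T" "\<And>i. i < N \<Longrightarrow> dist (\<phi> s (z i)) (z i) < e"
    "\<And>c. c \<in> C \<Longrightarrow> \<exists>i<N. dist (\<phi> s c) (z i) < e"
    using collapse[OF xz(2) _ _ e(1)] by metis
  have "\<phi> s (z 0) \<in> A2"
    using s(2)[OF tuples(1)] e(3) by (intro subsetD[OF e2(2)]) (simp add: dist_commute)
  then have "\<pi> (\<phi> s (z 0)) \<in> O2"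
    using A2(2) act_closed[OF s(1)] tuple_nth[OF xz(2) tuples(1)] by blast
  then have "\<psi> s y \<in> O2"
    using factor(3)[OF s(1) tuple_nth[OF xz(2) tuples(1)]] xz(3) by (simp add: y_def)
  \<comment> \<open>Openness of \<open>proj\<close> at q: s moves y only slightly, so U1 still
    contains a point over \<psi> s y.\<close>
  then have "\<psi> s y \<in> proj ` (E \<inter> (U1 \<times> V1))"
    using O2(3) Y.act_closed[OF s(1) y(1)] by blast
  then obtain r where r: "r \<in> E" "r \<in> U1 \<times> V1" "proj r = \<psi> s y"
    by force
  define xs where "xs = fst r"
  have xs: "xs \<in> X" "xs \<in> U1" "\<pi> xs = \<psi> s y"
    using r by (auto simp: xs_def E_def proj_def)
  define x' where "x' = \<phi> (inv s) xs"
  have x': "x' \<in> X" "\<pi> x' = y" "\<phi> s x' = xs"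
    using xs s(1) act_closed act_inv' factor(3) Y.act_inv y(1) by (auto simp: x'_def)
  obtain t where t: "t \<in> F" "\<phi> t x' \<in> A \<inter> A1"
    using F(3) x'(1) by blast
  then have tF: "t \<in> F'" "t \<in> carrier T"
    using x' F(2) by (auto simp: F'_def)
  \<comment> \<open>g sends \<phi> t x' to xs in U1; on the tuple \<open>b t\<close> it undoes t and
    then collapses by s.\<close>
  define g where "g = s \<otimes> inv t"
  have g: "g \<in> carrier T"
    using s(1) tF by (simp add: g_def)
  let ?r = "(\<phi> t x', b t)"
  have rE: "?r \<in> E" "proj ?r = \<psi> t y"
    using b tF x' act_closed factor(3) by (auto simp: E_def proj_def)
  have gb: "\<phi> g (b t i) = \<phi> s (\<phi> (inv t) (b t i))" if "i < N" for i
    using that b(1)[OF tF(1)] tuple_nth s(1) tF(2) by (simp add: g_def act_mult)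
  have "\<exists>k<N. dist (\<phi> g (b t i)) (z k) < e" if "i < N" for i
    using s(3)[of "\<phi> (inv t) (b t i)"] gb[OF that] that tF(1) by (auto simp: C_def)
  then obtain \<kappa> where \<kappa>: "\<And>i. i < N \<Longrightarrow> \<kappa> i < N"
    "\<And>i. i < N \<Longrightarrow> dist (\<phi> g (b t i)) (z (\<kappa> i)) < e"
    by metis
  define w where "w = power_action X N \<phi> g (b t)"
  have w: "w \<in> M" "\<And>i. i < N \<Longrightarrow> w i = \<phi> g (b t i)"
    using tuples b(1)[OF tF(1)] g by (auto simp: w_def power_action_apply subset_iff)
  have "inj_on \<kappa> {..<N}"
  proof (rule inj_onI, rule ccontr)
    fix i j
    assume ij: "i \<in> {..<N}" "j \<in> {..<N}" "\<kappa> i = \<kappa> j" "i \<noteq> j"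
    then have "dist (w i) (w j) < \<delta>"
      using \<kappa>(2)[of i] \<kappa>(2)[of j] w(2)[of i] w(2)[of j] e(4)
        dist_triangle2[of "w i" "w j" "z (\<kappa> i)"] by simp
    then show False
      using separated(2)[OF w(1), of i j] ij by simp
  qed
  then have bij: "bij_betw \<kappa> {..<N} {..<N}"
    using endo_inj_surj[of "{..<N}" \<kappa>] \<kappa>(1) by (auto simp: bij_betw_def)
  \<comment> \<open>\<open>permutes\<close> demands the identity outside the index set.\<close>
  define \<rho> where "\<rho> i = (if i < N then \<kappa> i else i)" for i
  have "bij_betw \<rho> {..<N} {..<N}"
    using bij by (rule bij_betw_cong[THEN iffD1, rotated]) (simp add: \<rho>_def)
  then have \<rho>: "\<rho> permutes {..<N}"
    by (rule bij_imp_permutes) (simp add: \<rho>_def)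
  \<comment> \<open>\<open>act\<close> puts coordinate \<sigma> i at place i, so \<sigma> has to
    invert \<kappa>.\<close>
  obtain \<sigma> where \<sigma>: "\<sigma> permutes {..<N}" "\<And>i. i < N \<Longrightarrow> \<kappa> (\<sigma> i) = i"
  proof
    show \<rho>': "Hilbert_Choice.inv \<rho> permutes {..<N}"
      using \<rho> by (rule permutes_inv)
    fix i
    assume "i < N"
    then have "Hilbert_Choice.inv \<rho> i < N" "\<rho> (Hilbert_Choice.inv \<rho> i) = i"
      using permutes_in_image[OF \<rho>', of i] permutes_inverses(1)[OF \<rho>] by simp_all
    then show "\<kappa> (Hilbert_Choice.inv \<rho> i) = i"
      by (simp add: \<rho>_def)
  qed
  have \<sigma>N: "\<sigma> i < N" if "i < N" for i
    using permutes_in_image[OF \<sigma>(1), of i] that by simp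
  have "(\<lambda>i\<in>{..<N}. \<phi> g (b t (\<sigma> i))) \<in> V1"
  proof (rule e1(2))
    show "(\<lambda>i\<in>{..<N}. \<phi> g (b t (\<sigma> i))) \<in> power_space X N"
      using \<sigma>N b(1)[OF tF(1)] tuple_nth act_closed[OF g] by (auto simp: power_space_def)
    show "dist ((\<lambda>i\<in>{..<N}. \<phi> g (b t (\<sigma> i))) i) (z i) < e1" if "i < N" for i
      using \<kappa>(2)[OF \<sigma>N[OF that]] \<sigma>(2)[OF that] that e(2) by simp
  qed
  moreover have "\<phi> g (\<phi> t x') \<in> U1"
    using x' xs(2) g tF(2) s(1) act_closed by (simp add: g_def act_mult act_inv)
  ultimately have "act g \<sigma> ?r \<in> U"
    using UV(4) by (auto simp: act_def)
  moreover have "?r \<in> \<Omega>"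
    using AB(4) t(2) b(2)[OF tF(1)] by blast
  moreover have "open_at (proj ?r)"
    using open_at_act[OF y(1) _ tF(2)] rE(2) U(4) y(2) by simp
  ultimately show thesis
    using that rE(1) g \<sigma>(1) by blast
qed

text \<open>Density of the orbit is asked only over base points where \<open>proj\<close> is open,
  as \<open>box_transitive\<close> gives no more; the images of p themselves may lie outside
  E.\<close>

definition transitive :: "'x \<times> (nat \<Rightarrow> 'x) \<Rightarrow> bool" where
  "transitive p \<longleftrightarrow> (\<forall>q U. q \<in> E \<and> open_at (proj q) \<and> open U \<and> q \<in> U \<longrightarrow>
    (\<exists>g\<in>carrier T. \<exists>\<sigma>. \<sigma> permutes {..<N} \<and> act g \<sigma> p \<in> U))"

lemma generic_transitive:
  obtains R where "residual_in Y R" "\<And>y. y \<in> R \<Longrightarrow> open_at y"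
    "\<And>p U. p \<in> E \<Longrightarrow> proj p \<in> R \<Longrightarrow> open U \<Longrightarrow> p \<in> U \<Longrightarrow>
      \<exists>q\<in>E \<inter> U. proj q = proj p \<and> transitive q"
proof -
  obtain \<B> where B: "countable \<B>" "\<And>B. B \<in> \<B> \<Longrightarrow> open B"
    "\<And>U p. open U \<Longrightarrow> p \<in> E \<Longrightarrow> p \<in> U \<Longrightarrow> \<exists>B\<in>\<B>. p \<in> B \<and> closure B \<subseteq> U"
    using compact_countable_base[OF compact_E] by blast
  define \<B>' where "\<B>' = {B \<in> \<B>. \<exists>q\<in>E \<inter> B. open_at (proj q)}"
  define G where "G B = {p \<in> E. \<exists>g\<in>carrier T. \<exists>\<sigma>. \<sigma> permutes {..<N} \<and> act g \<sigma> p \<in> B}" for B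
  have op: "openin (top_of_set E) (G B)" if "B \<in> \<B>'" for B
  proof -
    have "openin (top_of_set E) (E \<inter> act g \<sigma> -` B)"
      if "g \<in> carrier T" "\<sigma> permutes {..<N}" for g \<sigma>
      using continuous_on_subset[OF continuous_on_act[OF that] E_subset] B(2) \<open>B \<in> \<B>'\<close>
      by (intro continuous_openin_preimage_gen) (auto simp: \<B>'_def)
    then have "openin (top_of_set E)
        (\<Union>g\<in>carrier T. \<Union>\<sigma>\<in>{\<sigma>. \<sigma> permutes {..<N}}. E \<inter> act g \<sigma> -` B)"
      by blast
    moreover have "(\<Union>g\<in>carrier T. \<Union>\<sigma>\<in>{\<sigma>. \<sigma> permutes {..<N}}. E \<inter> act g \<sigma> -` B) = G B"
      unfolding G_def by blast
    ultimately show ?thesis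
      by simp
  qed
  have dense: "\<exists>r\<in>U \<inter> G B. open_at (proj r)"
    if dp: "B \<in> \<B>'" "open U" "p \<in> E" "p \<in> U" "open_at (proj p)" for B U p
  proof -
    have "open B"
      using \<open>B \<in> \<B>'\<close> B(2) by (simp add: \<B>'_def)
    moreover obtain q where "q \<in> E" "q \<in> B" "open_at (proj q)"
      using \<open>B \<in> \<B>'\<close> by (auto simp: \<B>'_def)
    ultimately have q: "q \<in> E" "q \<in> B" "open_at (proj q)" "open B"
      by simp_all
    obtain r g \<sigma> where "r \<in> E" "r \<in> U" "open_at (proj r)" "g \<in> carrier T" "\<sigma> permutes {..<N}"
      "act g \<sigma> r \<in> B"
      using box_transitive[OF dp(2-5) q(4,1-3)] by blast
    then show ?thesis
      by (intro bexI[of _ r]) (auto simp: G_def)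
  qed
  have "countable (G ` \<B>')"
    using B(1) by (simp add: \<B>'_def)
  moreover have "proj ` E \<subseteq> Y"
    using proj_in by blast
  ultimately obtain R where R: "residual_in Y R" "\<And>y. y \<in> R \<Longrightarrow> open_at y"
    "\<And>y H U p. y \<in> R \<Longrightarrow> H \<in> G ` \<B>' \<Longrightarrow> open U \<Longrightarrow> p \<in> E \<Longrightarrow> p \<in> U \<Longrightarrow> proj p = y \<Longrightarrow>
      \<exists>q\<in>U \<inter> H. proj q = y"
    using dense_in_generic_fiber[OF compact_E continuous_on_proj, of Y "G ` \<B>'"] op dense
    by (smt (verit, best) imageE)
  have "\<exists>q\<in>E \<inter> U. proj q = proj p \<and> transitive q"
    if p: "p \<in> E" "proj p \<in> R" and U: "open U" "p \<in> U" for p U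
  proof -
    \<comment> \<open>The fibre of \<open>proj\<close> is compact and each \<open>G B\<close> is
      dense in it, so Baire category inside the fibre gives one point that is good for all
      B.\<close>
    define K where "K = {q \<in> E. proj q = proj p}"
    have "closedin (top_of_set E) K"
      using continuous_closedin_preimage_constant[OF continuous_on_proj, of "proj p"]
      by (simp add: K_def)
    then have K: "compact K"
      using closedin_compact compact_E by blast
    have opK: "openin (top_of_set K) H" if H: "H \<in> (\<lambda>B. G B \<inter> K) ` \<B>'" for H
    proof -
      obtain B where B: "B \<in> \<B>'" "H = G B \<inter> K"
        using H by blast
      obtain O' where "open O'" "G B = E \<inter> O'"
        using op[OF B(1)] unfolding openin_open by blast
      moreover have "E \<inter> O' \<inter> K = K \<inter> O'"
        by (auto simp: K_def)
      ultimately show ?thesis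
        using B(2) by (simp add: openin_open_Int)
    qed
    have denseK: "V \<inter> H \<noteq> {}"
      if H: "H \<in> (\<lambda>B. G B \<inter> K) ` \<B>'" and V: "open V" "V \<inter> K \<noteq> {}" for H V
    proof -
      obtain v where v: "v \<in> V" "v \<in> E" "proj v = proj p"
        using V by (auto simp: K_def)
      obtain B where "B \<in> \<B>'" "H = G B \<inter> K"
        using H by blast
      moreover obtain q where "q \<in> V \<inter> G B" "proj q = proj p"
        using R(3)[OF p(2) imageI[OF \<open>B \<in> \<B>'\<close>] V(1) v(2,1,3)] by blast
      ultimately show ?thesis
        by (auto simp: K_def G_def)
    qed
    have "U \<inter> K \<noteq> {}" "countable ((\<lambda>B. G B \<inter> K) ` \<B>')"
      using p U B(1) by (auto simp: K_def \<B>'_def)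
    then obtain q where q: "q \<in> U \<inter> K" "\<And>H. H \<in> (\<lambda>B. G B \<inter> K) ` \<B>' \<Longrightarrow> q \<in> H"
      using compact_Baire[OF K U(1) _ _ opK denseK] by blast
    have "transitive q"
      unfolding transitive_def
    proof (intro allI impI)
      fix r V
      assume r: "r \<in> E \<and> open_at (proj r) \<and> open V \<and> r \<in> V"
      then obtain B where B: "B \<in> \<B>" "r \<in> B" "closure B \<subseteq> V"
        using B(3) by metis
      then have "B \<in> \<B>'"
        using r by (auto simp: \<B>'_def)
      then have "q \<in> G B"
        using q(2) by blast
      then show "\<exists>g\<in>carrier T. \<exists>\<sigma>. \<sigma> permutes {..<N} \<and> act g \<sigma> q \<in> V"
        using B(3) closure_subset by (fastforce simp: G_def)
    qed
    then show ?thesis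
      using q(1) by (auto simp: K_def)
  qed
  then show thesis
    using that R by blast
qed

section \<open>Perfect fibres and recurrent pairs\<close>

lemma transitiveD:
  assumes "transitive p" "q \<in> E" "open_at (proj q)" "open U" "q \<in> U"
  obtains g \<sigma> where "g \<in> carrier T" "\<sigma> permutes {..<N}" "act g \<sigma> p \<in> U"
  using assms unfolding transitive_def by blast

text \<open>If x were isolated in the fibre, a transitive point (x1, z1) near some (x, z) with z 0 =
  x would satisfy x1 = z1 0 = x. That the first entry is a coordinate of the tuple survives
  translations and permutations, so the orbit stays away from (x2, z1) for x2 in the infinite fibre
  off the coordinates of z1.\<close>

lemma generic_fiber_perfect:
  assumes y: "open_at y" "infinite (fiber X \<pi> y)"
    and trans: "\<And>p U. p \<in> E \<Longrightarrow> proj p = y \<Longrightarrow> open U \<Longrightarrow> p \<in> U \<Longrightarrow>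
      \<exists>q\<in>E \<inter> U. proj q = y \<and> transitive q"
    and V: "open V" "V \<inter> fiber X \<pi> y \<noteq> {}"
  shows "infinite (V \<inter> fiber X \<pi> y)"
proof
  assume fin: "finite (V \<inter> fiber X \<pi> y)"
  obtain x where x: "x \<in> V" "x \<in> X" "\<pi> x = y"
    using V(2) by (auto simp: fiber_def)
  define V' where "V' = V - (V \<inter> fiber X \<pi> y - {x})"
  have V': "open V'" "x \<in> V'" "\<And>u. u \<in> V' \<Longrightarrow> u \<in> fiber X \<pi> y \<Longrightarrow> u = x"
    using V(1) fin x by (auto simp: V'_def intro!: open_Diff finite_imp_closed)
  obtain z where z: "z \<in> M" "z 0 = x"
    using first_coordinate x(2) by blast
  have "open (V' \<times> (\<lambda>w. w (0::nat)) -` V')"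
    by (rule open_Times[OF V'(1) open_vimage[OF V'(1) continuous_on_product_coordinates]])
  moreover have "(x, z) \<in> E" "proj (x, z) = y" "(x, z) \<in> V' \<times> (\<lambda>w. w 0) -` V'"
    using x z V'(2) by (auto simp: E_def proj_def)
  ultimately obtain q where q: "q \<in> E" "q \<in> V' \<times> (\<lambda>w. w 0) -` V'" "proj q = y" "transitive q"
    using trans[of "(x, z)"] by blast
  obtain x1 z1 where q_eq: "q = (x1, z1)"
    by force
  have z1: "z1 \<in> M" "\<pi> (z1 0) = y" "z1 0 \<in> X"
    using q q_eq tuple_nth tuples(1) by (auto simp: E_def proj_def)
  have "x1 = x"
    using V'(3) q q_eq by (auto simp: fiber_def E_def proj_def)
  moreover have "z1 0 = x"
    using V'(3) q q_eq z1 by (auto simp: fiber_def)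
  ultimately have x1: "x1 = z1 0"
    by simp
  have "infinite (fiber X \<pi> y - z1 ` {..<N})"
    using y(2) by (simp add: Diff_infinite_finite)
  then obtain x2 where "x2 \<in> fiber X \<pi> y - z1 ` {..<N}"
    using infinite_imp_nonempty by blast
  then have x2: "x2 \<in> X" "\<pi> x2 = y" "x2 \<notin> z1 ` {..<N}"
    by (auto simp: fiber_def)
  define U where "U = (\<Inter>i\<in>{..<N}. {p :: 'x \<times> (nat \<Rightarrow> 'x). fst p \<noteq> snd p i})"
  have "open U"
    unfolding U_def
  proof (intro open_INT ballI finite_lessThan)
    fix i
    have "continuous_on UNIV (\<lambda>p :: 'x \<times> (nat \<Rightarrow> 'x). snd p i)"
      by (rule continuous_on_product_then_coordinatewise) (intro continuous_on_snd continuous_on_id)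
    then show "open {p :: 'x \<times> (nat \<Rightarrow> 'x). fst p \<noteq> snd p i}"
      by (intro open_Collect_neq continuous_on_fst continuous_on_id)
  qed
  moreover have "(x2, z1) \<in> E" "(x2, z1) \<in> U" "proj (x2, z1) = y"
    using x2 z1 by (auto simp: E_def U_def proj_def)
  ultimately obtain g \<sigma> where g: "\<sigma> permutes {..<N}" "act g \<sigma> q \<in> U"
    using transitiveD[OF q(4), of "(x2, z1)" U] y(1) by metis
  obtain i where i: "i < N" "\<sigma> i = 0"
    using permutes_image[OF g(1)] tuples(1) by (metis imageE lessThan_iff)
  then have "fst (act g \<sigma> q) = snd (act g \<sigma> q) i"
    using x1 q_eq by (simp add: act_def)
  then show False
    using g(2) i(1) by (auto simp: U_def)
qed

text \<open>For the identity permutation this is recurrence of p under T.\<close>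

definition returns :: "(nat \<Rightarrow> nat) \<Rightarrow> 'x \<times> (nat \<Rightarrow> 'x) \<Rightarrow> bool" where
  "returns \<sigma> p \<longleftrightarrow> (\<forall>U. open U \<and> p \<in> U \<longrightarrow> infinite {g \<in> carrier T. act g \<sigma> p \<in> U})"

text \<open>A single return along \<tau> carries a neighbourhood W of p into U, so each of the
  infinitely many returns along \<sigma> to W becomes one to U. Left multiplication keeps them
  distinct.\<close>

lemma returns_compose:
  assumes p: "p \<in> E" and \<sigma>: "\<sigma> permutes {..<N}" "returns \<sigma> p"
    and \<tau>: "\<tau> permutes {..<N}" "returns \<tau> p"
  shows "returns (\<sigma> \<circ> \<tau>) p"
  unfolding returns_def
proof (intro allI impI)
  fix U
  assume U: "open U \<and> p \<in> U"
  then have "infinite {g \<in> carrier T. act g \<tau> p \<in> U}"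
    using \<tau>(2) by (simp add: returns_def)
  then obtain g where g: "g \<in> carrier T" "act g \<tau> p \<in> U"
    by (metis (no_types, lifting) empty_Collect_eq finite.emptyI)
  obtain W where W: "open W" "\<And>p. p \<in> X \<times> power_space X N \<Longrightarrow> p \<in> W \<longleftrightarrow> act g \<tau> p \<in> U"
    using act_vimage_open[OF g(1) \<tau>(1)] U by blast
  have pX: "p \<in> X \<times> power_space X N"
    using p E_subset by blast
  then have "infinite {h \<in> carrier T. act h \<sigma> p \<in> W}" (is "infinite ?H")
    using \<sigma>(2) W g(2) by (simp add: returns_def)
  moreover have "inj_on (\<lambda>h. g \<otimes> h) ?H"
    using g(1) by (auto intro!: inj_onI)
  ultimately have "infinite ((\<lambda>h. g \<otimes> h) ` ?H)"
    using finite_imageD by blast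
  moreover have "(\<lambda>h. g \<otimes> h) ` ?H \<subseteq> {g \<in> carrier T. act g (\<sigma> \<circ> \<tau>) p \<in> U}"
  proof (rule image_subsetI)
    fix h
    assume h: "h \<in> ?H"
    have "act h \<sigma> p \<in> X \<times> power_space X N"
      using act_in_power h \<sigma>(1) pX by blast
    from W(2)[OF this] have "act g \<tau> (act h \<sigma> p) \<in> U"
      using h by simp
    then show "g \<otimes> h \<in> {g \<in> carrier T. act g (\<sigma> \<circ> \<tau>) p \<in> U}"
      using act_act[OF g(1) _ \<tau>(1) \<sigma>(1) pX] h g(1) by simp
  qed
  ultimately show "infinite {g \<in> carrier T. act g (\<sigma> \<circ> \<tau>) p \<in> U}"
    using infinite_super by blast
qed

text \<open>Finitely many return times would give only the finite set P of return points in U.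
  Perfectness offers a point (x, snd p) of E in U off P, and the dense orbit of p must enter U - P
  near it.\<close>

lemma transitive_returns:
  assumes p: "p \<in> E" "transitive p" "open_at (proj p)"
    and perfect: "\<And>V. open V \<Longrightarrow> V \<inter> fiber X \<pi> (proj p) \<noteq> {} \<Longrightarrow>
      infinite (V \<inter> fiber X \<pi> (proj p))"
  obtains \<sigma> where "\<sigma> permutes {..<N}" "returns \<sigma> p"
proof -
  let ?S = "{\<sigma>. \<sigma> permutes {..<N}}"
  have inf: "infinite {g \<in> carrier T. \<exists>\<sigma>\<in>?S. act g \<sigma> p \<in> U}" if U: "open U" "p \<in> U" for U
  proof
    let ?F = "{g \<in> carrier T. \<exists>\<sigma>\<in>?S. act g \<sigma> p \<in> U}"
    assume fin: "finite ?F"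
    define P where "P = (\<lambda>(g, \<sigma>). act g \<sigma> p) ` (?F \<times> ?S)"
    have "finite ?S"
      by (simp add: finite_permutations)
    then have P: "finite P"
      using fin by (simp add: P_def)
    obtain A B where AB: "open A" "open B" "p \<in> A \<times> B" "A \<times> B \<subseteq> U"
      using open_prod_elim[OF U] by metis
    have "A \<inter> fiber X \<pi> (proj p) \<noteq> {}"
      using AB(3) p(1) by (auto simp: fiber_def E_def proj_def)
    then have "infinite (A \<inter> fiber X \<pi> (proj p) - fst ` P)"
      using perfect[OF AB(1)] P by (simp add: Diff_infinite_finite)
    then obtain x where "x \<in> A \<inter> fiber X \<pi> (proj p) - fst ` P"
      using infinite_imp_nonempty by blast
    then have x: "x \<in> A" "x \<in> X" "\<pi> x = proj p" "x \<notin> fst ` P"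
      by (auto simp: fiber_def)
    have "(x, snd p) \<in> E" "proj (x, snd p) = proj p" "(x, snd p) \<in> U - P"
      using x p(1) AB by (auto simp: E_def proj_def image_iff)
    moreover have "open (U - P)"
      using U(1) P by (simp add: finite_imp_closed open_Diff)
    ultimately obtain g \<sigma> where g: "g \<in> carrier T" "\<sigma> permutes {..<N}" "act g \<sigma> p \<in> U - P"
      using transitiveD[OF p(2), of "(x, snd p)" "U - P"] p(3) by metis
    then have "(g, \<sigma>) \<in> ?F \<times> ?S"
      by auto
    then have "act g \<sigma> p \<in> P"
      unfolding P_def by (rule rev_image_eqI) simp
    then show False
      using g(3) by blast
  qed
  \<comment> \<open>Pigeonhole: if every permutation failed at its own neighbourhood of p, only
    finitely many translations would bring p back into their intersection.\<close>
  have "\<exists>\<sigma>\<in>?S. returns \<sigma> p"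
  proof (rule ccontr)
    assume "\<not> (\<exists>\<sigma>\<in>?S. returns \<sigma> p)"
    then have "\<forall>\<sigma>\<in>?S. \<exists>U. open U \<and> p \<in> U \<and> finite {g \<in> carrier T. act g \<sigma> p \<in> U}"
      by (auto simp: returns_def)
    then obtain U where "\<forall>\<sigma>\<in>?S. open (U \<sigma>) \<and> p \<in> U \<sigma> \<and> finite {g \<in> carrier T. act g \<sigma> p \<in> U \<sigma>}"
      unfolding bchoice_iff by blast
    then have U: "\<And>\<sigma>. \<sigma> \<in> ?S \<Longrightarrow> open (U \<sigma>)" "\<And>\<sigma>. \<sigma> \<in> ?S \<Longrightarrow> p \<in> U \<sigma>"
      "\<And>\<sigma>. \<sigma> \<in> ?S \<Longrightarrow> finite {g \<in> carrier T. act g \<sigma> p \<in> U \<sigma>}"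
      by auto
    have S: "finite ?S"
      by (simp add: finite_permutations)
    define U' where "U' = (\<Inter>\<sigma>\<in>?S. U \<sigma>)"
    have U': "open U'" "p \<in> U'"
      unfolding U'_def using U(1,2) by (intro open_INT S ballI INT_I; simp)+
    have "{g \<in> carrier T. \<exists>\<sigma>\<in>?S. act g \<sigma> p \<in> U'} \<subseteq>
        (\<Union>\<sigma>\<in>?S. {g \<in> carrier T. act g \<sigma> p \<in> U \<sigma>})"
      by (auto simp: U'_def)
    moreover have "finite (\<Union>\<sigma>\<in>?S. {g \<in> carrier T. act g \<sigma> p \<in> U \<sigma>})"
      using U(3) by (intro finite_UN_I S)
    ultimately show False
      using inf[OF U'] finite_subset by blast
  qed
  then show thesis
    using that by blast
qed

text \<open>The permutations along which \<open>p\<close> returns form a subsemigroup of a finite group.\<close>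

lemma returns_id:
  assumes p: "p \<in> E" and \<sigma>: "\<sigma> permutes {..<N}" "returns \<sigma> p"
  shows "returns id p"
proof -
  have "permutation \<sigma>"
    using \<sigma>(1) permutation_permutes by blast
  then obtain n where n: "(\<sigma> ^^ n) = id" "n > 0"
    using permutation_is_nilpotent by blast
  \<comment> \<open>Powers start at 1, since the power 0 is the identity, for which the claim is
    still open.\<close>
  have "returns (\<sigma> ^^ Suc k) p" for k
  proof (induction k)
    case (Suc k)
    have "(\<sigma> ^^ Suc k) permutes {..<N}"
      using \<sigma>(1) by (rule permutes_funpow)
    then show ?case
      unfolding funpow.simps(2)[of "Suc k"] by (rule returns_compose[OF p \<sigma> _ Suc])
  qed (simp add: \<sigma>(2))
  then show ?thesis
    using n by (metis Suc_pred)
qed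

text \<open>Any pair in the fibre is approximated by (x, z 0) with (x, z) transitive, and a return
  of (x, z) without permutation is in particular a return of this pair.\<close>

lemma generic_recurrent:
  assumes y: "open_at y" "infinite (fiber X \<pi> y)"
    and trans: "\<And>p U. p \<in> E \<Longrightarrow> proj p = y \<Longrightarrow> open U \<Longrightarrow> p \<in> U \<Longrightarrow>
      \<exists>q\<in>E \<inter> U. proj q = y \<and> transitive q"
    and V: "open V" "V \<inter> fiber X \<pi> y \<noteq> {}" and W: "open W" "W \<inter> fiber X \<pi> y \<noteq> {}"
  obtains x x' where "x \<in> V \<inter> fiber X \<pi> y" "x' \<in> W \<inter> fiber X \<pi> y"
    "recurrent_point T (pair_action X \<phi>) (x, x')"
proof -
  obtain x1 x2 where x: "x1 \<in> V" "x1 \<in> X" "\<pi> x1 = y" "x2 \<in> W" "x2 \<in> X" "\<pi> x2 = y"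
    using V(2) W(2) by (auto simp: fiber_def)
  obtain z2 where z2: "z2 \<in> M" "z2 0 = x2"
    using first_coordinate x(5) by blast
  have open0: "open (A \<times> (\<lambda>w. w (0::nat)) -` B)" if "open A" "open B" for A B :: "'x set"
    using open_Times[OF that(1) open_vimage[OF that(2) continuous_on_product_coordinates]] .
  have "(x1, z2) \<in> E" "proj (x1, z2) = y" "(x1, z2) \<in> V \<times> (\<lambda>w. w 0) -` W"
    using x z2 by (auto simp: E_def proj_def)
  then obtain q where q: "q \<in> E" "q \<in> V \<times> (\<lambda>w. w 0) -` W" "proj q = y" "transitive q"
    using trans[of "(x1, z2)"] open0[OF V(1) W(1)] by blast
  have "open_at (proj q)"
    using q(3) y(1) by simp
  moreover have "infinite (A \<inter> fiber X \<pi> (proj q))"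
    if "open A" "A \<inter> fiber X \<pi> (proj q) \<noteq> {}" for A
    using generic_fiber_perfect[OF y trans that(1)] that(2) q(3) by simp
  ultimately obtain \<sigma> where "\<sigma> permutes {..<N}" "returns \<sigma> q"
    using transitive_returns[OF q(1,4)] by metis
  then have ret: "returns id q"
    using returns_id[OF q(1)] by blast
  obtain x z where xz: "q = (x, z)"
    by force
  have x': "x \<in> X" "\<pi> x = y" "z \<in> M" "z 0 \<in> X" "\<pi> (z 0) = y" "x \<in> V" "z 0 \<in> W"
    using q xz tuple_nth tuples(1) by (auto simp: E_def proj_def)
  have "recurrent_point T (pair_action X \<phi>) (x, z 0)"
    unfolding recurrent_point_def
  proof (intro allI impI)
    fix U
    assume U: "open U \<and> (x, z 0) \<in> U"
    then obtain A B where AB: "open A" "open B" "(x, z 0) \<in> A \<times> B" "A \<times> B \<subseteq> U"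
      using open_prod_elim by metis
    then have "infinite {g \<in> carrier T. act g id q \<in> A \<times> (\<lambda>w. w 0) -` B}"
      using ret open0[OF AB(1,2)] xz by (simp add: returns_def)
    moreover have "{g \<in> carrier T. act g id q \<in> A \<times> (\<lambda>w. w 0) -` B} \<subseteq>
        {g \<in> carrier T. pair_action X \<phi> g (x, z 0) \<in> U}"
      using AB(4) x' tuples(1) xz by (auto simp: act_def pair_action_def)
    ultimately show "infinite {g \<in> carrier T. pair_action X \<phi> g (x, z 0) \<in> U}"
      using infinite_super by blast
  qed
  then show thesis
    using that x' by (auto simp: fiber_def)
qed

end

subsection \<open>Scrambled sets in a fibre\<close>

text \<open>Splits proximality into countably many conditions that are open by continuity, as
  \<open>uncountable_clique\<close> requires.\<close>

lemma (in compact_action) proximal_pair_iff: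
  "proximal_pair T a x x' \<longleftrightarrow> (\<forall>k. \<exists>t\<in>carrier T. dist (a t x) (a t x') < inverse (Suc k))"
proof -
  let ?f = "\<lambda>t. dist (a t x) (a t x')"
  have bdd: "bdd_below (?f ` carrier T)" "?f ` carrier T \<noteq> {}"
    by (auto intro: bdd_belowI[of _ 0])
  have "proximal_pair T a x x' \<longleftrightarrow> (INF t\<in>carrier T. ?f t) \<le> 0"
    using cINF_greatest[of "carrier T" 0 ?f] bdd(2) by (auto simp: proximal_pair_def)
  also have "\<dots> \<longleftrightarrow> (\<forall>k. (INF t\<in>carrier T. ?f t) < inverse (Suc k))"
  proof
    assume "\<forall>k. (INF t\<in>carrier T. ?f t) < inverse (Suc k)"
    then show "(INF t\<in>carrier T. ?f t) \<le> 0"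
      by (meson not_less reals_Archimedean less_asym)
  next
    assume "(INF t\<in>carrier T. ?f t) \<le> 0"
    then show "\<forall>k. (INF t\<in>carrier T. ?f t) < inverse (Suc k)"
      by (meson le_less_trans inverse_positive_iff_positive of_nat_0_less_iff zero_less_Suc)
  qed
  also have "\<dots> \<longleftrightarrow> (\<forall>k. \<exists>t\<in>carrier T. ?f t < inverse (Suc k))"
    using bdd cINF_less_iff[of "carrier T" ?f] by auto
  finally show ?thesis .
qed

text \<open>
  If proximal pairs were dense in no box \<open>U \<times> U\<close>, splitting boxes repeatedly would give arbitrarily
  many pairwise distal points.
\<close>

lemma (in compact_action) ex_proximal_dense_open:
  assumes K: "K \<noteq> {}"
    and bound: "\<And>S. S \<subseteq> K \<Longrightarrow> finite S \<Longrightarrow>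
      (\<And>x x'. x \<in> S \<Longrightarrow> x' \<in> S \<Longrightarrow> x \<noteq> x' \<Longrightarrow> \<not> proximal_pair T a x x') \<Longrightarrow> card S \<le> n"
  obtains U where "open U" "U \<inter> K \<noteq> {}"
    "\<And>V W k. open V \<Longrightarrow> open W \<Longrightarrow> V \<subseteq> U \<Longrightarrow> W \<subseteq> U \<Longrightarrow> V \<inter> K \<noteq> {} \<Longrightarrow> W \<inter> K \<noteq> {} \<Longrightarrow>
      \<exists>x\<in>V \<inter> K. \<exists>x'\<in>W \<inter> K. \<exists>t\<in>carrier T. dist (a t x) (a t x') < inverse (Suc k)"
proof (rule ccontr)
  let ?D = "\<lambda>x x'. \<not> proximal_pair T a x x'"
  assume neg: "\<not> thesis"
  note result = that
  \<comment> \<open>W is not asked to be open: the splitting continues inside V, and W only supplies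
    one further point.\<close>
  have step: "\<exists>V W. open V \<and> V \<subseteq> U \<and> V \<inter> K \<noteq> {} \<and> W \<subseteq> U \<and> W \<inter> K \<noteq> {} \<and>
      (\<forall>x\<in>V \<inter> K. \<forall>x'\<in>W \<inter> K. ?D x x')"
    if U: "open U" "U \<inter> K \<noteq> {}" for U
  proof (rule ccontr)
    assume *: "\<not> ?thesis"
    have "\<exists>x\<in>V \<inter> K. \<exists>x'\<in>W \<inter> K. \<exists>t\<in>carrier T. dist (a t x) (a t x') < inverse (Suc k)"
      if "open V" "open W" "V \<subseteq> U" "W \<subseteq> U" "V \<inter> K \<noteq> {}" "W \<inter> K \<noteq> {}" for V W k
    proof -
      have "\<not> (\<forall>x\<in>V \<inter> K. \<forall>x'\<in>W \<inter> K. ?D x x')"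
        using * that by metis
      then obtain x x' where "x \<in> V \<inter> K" "x' \<in> W \<inter> K" "proximal_pair T a x x'"
        by blast
      then show ?thesis
        unfolding proximal_pair_iff by blast
    qed
    from result[OF U this] show False
      using neg by blast
  qed
  have "\<exists>S. S \<subseteq> U \<inter> K \<and> finite S \<and> card S = Suc m \<and>
      (\<forall>x\<in>S. \<forall>x'\<in>S. x \<noteq> x' \<longrightarrow> ?D x x')" if "open U" "U \<inter> K \<noteq> {}" for m U
    using that
  proof (induction m arbitrary: U)
    case 0
    then obtain x where "x \<in> U \<inter> K"
      by blast
    then show ?case
      by (intro exI[of _ "{x}"]) auto
  next
    case (Suc m)
    obtain V W where VW: "open V" "V \<subseteq> U" "V \<inter> K \<noteq> {}" "W \<subseteq> U" "W \<inter> K \<noteq> {}"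
      "\<forall>x\<in>V \<inter> K. \<forall>x'\<in>W \<inter> K. ?D x x'"
      using step[OF Suc.prems] by metis
    obtain S where S: "S \<subseteq> V \<inter> K" "finite S" "card S = Suc m"
      "\<forall>x\<in>S. \<forall>x'\<in>S. x \<noteq> x' \<longrightarrow> ?D x x'"
      using Suc.IH[OF VW(1,3)] by blast
    obtain v where v: "v \<in> W \<inter> K"
      using VW(5) by blast
    have Dv: "?D x v" "?D v x" if "x \<in> S" for x
    proof -
      show "?D x v"
        using VW(6) v S(1) that by blast
      moreover have "(\<lambda>t. dist (a t v) (a t x)) = (\<lambda>t. dist (a t x) (a t v))"
        by (simp add: dist_commute)
      ultimately show "?D v x"
        unfolding proximal_pair_def by metis
    qed
    \<comment> \<open>A point is proximal to itself, so v, being distal from all of S, is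
      new.\<close>
    have "proximal_pair T a v v"
      unfolding proximal_pair_iff by (auto intro: bexI[of _ \<one>])
    then have "v \<notin> S"
      using Dv by blast
    then show ?case
      using S v VW(2,4) Dv by (intro exI[of _ "insert v S"]) auto
  qed
  from this[of UNIV n] obtain S where "S \<subseteq> K" "finite S" "card S = Suc n"
    "\<forall>x\<in>S. \<forall>x'\<in>S. x \<noteq> x' \<longrightarrow> ?D x x'"
    using K by auto
  then show False
    using bound[of S] by auto
qed

lemma openin_Collect_bex:
  assumes "\<And>t. t \<in> B \<Longrightarrow> continuous_on S (h t)" "open A"
  shows "openin (top_of_set S) {p \<in> S. \<exists>t\<in>B. h t p \<in> A}"
proof -
  have "openin (top_of_set S) (S \<inter> h t -` A)" if "t \<in> B" for t
    using continuous_openin_preimage_gen[OF assms(1)[OF that] assms(2)] .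
  then have "openin (top_of_set S) (\<Union>t\<in>B. S \<inter> h t -` A)"
    by blast
  moreover have "(\<Union>t\<in>B. S \<inter> h t -` A) = {p \<in> S. \<exists>t\<in>B. h t p \<in> A}"
    by blast
  ultimately show ?thesis
    by simp
qed

lemma (in compact_action) uncountable_strongly_scrambled:
  assumes count: "countable (carrier T)" and K: "compact K" "K \<subseteq> Z" "K \<noteq> {}"
    and perfect: "\<And>V. open V \<Longrightarrow> V \<inter> K \<noteq> {} \<Longrightarrow> infinite (V \<inter> K)"
    and recurrent: "\<And>V W. open V \<Longrightarrow> V \<inter> K \<noteq> {} \<Longrightarrow> open W \<Longrightarrow> W \<inter> K \<noteq> {} \<Longrightarrow>
      \<exists>x\<in>V \<inter> K. \<exists>x'\<in>W \<inter> K. recurrent_point T (pair_action Z a) (x, x')"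
    and bound: "\<And>S. S \<subseteq> K \<Longrightarrow> finite S \<Longrightarrow>
      (\<And>x x'. x \<in> S \<Longrightarrow> x' \<in> S \<Longrightarrow> x \<noteq> x' \<Longrightarrow> \<not> proximal_pair T a x x') \<Longrightarrow> card S \<le> n"
  obtains S where "S \<subseteq> K" "uncountable S" "strongly_scrambled T Z a S"
proof -
  define P where "P k = {p \<in> K \<times> K. \<exists>t\<in>carrier T. dist (a t (fst p)) (a t (snd p)) < inverse (Suc k)}"
    for k :: nat
  \<comment> \<open>A pair is recurrent exactly when it returns to each of its neighbourhoods
    outside every finite F. This replaces infinitude of return times by open conditions, and
    countability of T leaves countably many F.\<close>
  define Q where "Q k F = {p \<in> K \<times> K. \<exists>t\<in>carrier T - F. dist (a t (fst p)) (fst p) < inverse (Suc k) \<and>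
    dist (a t (snd p)) (snd p) < inverse (Suc k)}" for k :: nat and F
  define \<F> where "\<F> = {F. finite F \<and> F \<subseteq> carrier T}"
  define \<G> where "\<G> = range P \<union> (\<lambda>(k, F). Q k F) ` (UNIV \<times> \<F>)"
  obtain U where U: "open U" "U \<inter> K \<noteq> {}"
    "\<And>V W k. open V \<Longrightarrow> open W \<Longrightarrow> V \<subseteq> U \<Longrightarrow> W \<subseteq> U \<Longrightarrow> V \<inter> K \<noteq> {} \<Longrightarrow> W \<inter> K \<noteq> {} \<Longrightarrow>
      \<exists>x\<in>V \<inter> K. \<exists>x'\<in>W \<inter> K. \<exists>t\<in>carrier T. dist (a t x) (a t x') < inverse (Suc k)"
    using ex_proximal_dense_open[OF K(3) bound] by blast
  have "countable \<F>"
    using countable_Collect_finite_subset[OF count] by (simp add: \<F>_def conj_commute)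
  then have count\<G>: "countable \<G>"
    by (simp add: \<G>_def)
  have op: "openin (top_of_set (K \<times> K)) G" if "G \<in> \<G>" for G
  proof -
    have cont: "continuous_on (K \<times> K) (\<lambda>p. a t (fst p))" "continuous_on (K \<times> K) (\<lambda>p. a t (snd p))"
      if "t \<in> carrier T" for t
      by (rule continuous_on_compose2[OF act_cont[OF that]];
          use K(2) in \<open>auto intro: continuous_on_fst continuous_on_snd continuous_on_id\<close>)+
    have "openin (top_of_set (K \<times> K)) (P k)" for k
    proof -
      have "P k = {p \<in> K \<times> K. \<exists>t\<in>carrier T. dist (a t (fst p)) (a t (snd p)) \<in> {..<inverse (Suc k)}}"
        by (simp add: P_def)
      also have "openin (top_of_set (K \<times> K)) \<dots>"
        by (intro openin_Collect_bex continuous_on_dist cont open_lessThan)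
      finally show ?thesis .
    qed
    moreover have "openin (top_of_set (K \<times> K)) (Q k F)" for k F
    proof -
      have "Q k F = {p \<in> K \<times> K. \<exists>t\<in>carrier T - F. max (dist (a t (fst p)) (fst p))
          (dist (a t (snd p)) (snd p)) \<in> {..<inverse (Suc k)}}"
        by (simp add: Q_def)
      also have "openin (top_of_set (K \<times> K)) \<dots>"
        by (intro openin_Collect_bex continuous_on_max continuous_on_dist cont open_lessThan
            continuous_on_fst continuous_on_snd continuous_on_id) auto
      finally show ?thesis .
    qed
    ultimately show ?thesis
      using that by (auto simp: \<G>_def)
  qed
  have sym: "(y, x) \<in> G" if "G \<in> \<G>" "(x, y) \<in> G" for G x y
    using that by (auto simp: \<G>_def P_def Q_def dist_commute)
  have dense: "(V \<times> W) \<inter> G \<noteq> {}"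
    if G: "G \<in> \<G>" and VW: "open V" "open W" "V \<subseteq> U" "W \<subseteq> U" "V \<inter> K \<noteq> {}" "W \<inter> K \<noteq> {}"
    for G V W
  proof -
    consider k where "G = P k" | k F where "G = Q k F" "F \<in> \<F>"
      using G by (auto simp: \<G>_def)
    then show ?thesis
    proof cases
      case 1
      obtain x x' where "x \<in> V \<inter> K" "x' \<in> W \<inter> K"
        "\<exists>t\<in>carrier T. dist (a t x) (a t x') < inverse (Suc k)"
        using U(3)[OF VW, of k] by blast
      then have "(x, x') \<in> (V \<times> W) \<inter> G"
        using 1 by (auto simp: P_def)
      then show ?thesis
        by blast
    next
      case 2
      obtain x x' where x: "x \<in> V \<inter> K" "x' \<in> W \<inter> K"
        "recurrent_point T (pair_action Z a) (x, x')"
        using recurrent[OF VW(1,5,2,6)] by blast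
      let ?B = "ball x (inverse (Suc k)) \<times> ball x' (inverse (Suc k))"
      have "open ?B" "(x, x') \<in> ?B"
        by (simp_all add: open_Times)
      then have "infinite {t \<in> carrier T. pair_action Z a t (x, x') \<in> ?B}"
        using x(3) unfolding recurrent_point_def by blast
      moreover have "finite F"
        using 2(2) by (simp add: \<F>_def)
      ultimately have "infinite ({t \<in> carrier T. pair_action Z a t (x, x') \<in> ?B} - F)"
        by (rule Diff_infinite_finite[rotated])
      then have "{t \<in> carrier T. pair_action Z a t (x, x') \<in> ?B} - F \<noteq> {}"
        by (rule infinite_imp_nonempty)
      then obtain t where "t \<in> {t \<in> carrier T. pair_action Z a t (x, x') \<in> ?B} - F"
        unfolding ex_in_conv[symmetric] by (elim exE)
      then have "t \<in> carrier T - F" "dist (a t x) x < inverse (Suc k)"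
        "dist (a t x') x' < inverse (Suc k)"
        using x(1,2) K(2) by (auto simp: pair_action_def dist_commute subset_iff)
      then have "(x, x') \<in> (V \<times> W) \<inter> G"
        using x(1,2) unfolding 2(1) Q_def by auto
      then show ?thesis
        by blast
    qed
  qed
  obtain S where S: "S \<subseteq> U \<inter> K" "uncountable S"
    "\<And>x y G. x \<in> S \<Longrightarrow> y \<in> S \<Longrightarrow> x \<noteq> y \<Longrightarrow> G \<in> \<G> \<Longrightarrow> (x, y) \<in> G"
    using uncountable_clique[OF K(1) U(1,2) perfect count\<G> op sym dense] by blast
  have "strong_Li_Yorke_pair T Z a x x'" if x: "x \<in> S" "x' \<in> S" "x \<noteq> x'" for x x'
    unfolding strong_Li_Yorke_pair_def
  proof (intro conjI)
    show xZ: "x \<in> Z" "x' \<in> Z"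
      using x S(1) K(2) by auto
    have "(x, x') \<in> P k" for k
      using S(3)[OF x] by (auto simp: \<G>_def)
    then show "proximal_pair T a x x'"
      unfolding proximal_pair_iff by (auto simp: P_def)
    show "recurrent_point T (pair_action Z a) (x, x')"
      unfolding recurrent_point_def
    proof (intro allI impI notI)
      fix V
      assume V: "open V \<and> (x, x') \<in> V"
        and fin: "finite {t \<in> carrier T. pair_action Z a t (x, x') \<in> V}" (is "finite ?F")
      obtain A B where AB: "open A" "open B" "(x, x') \<in> A \<times> B" "A \<times> B \<subseteq> V"
        using V open_prod_elim by metis
      obtain e1 e2 where e: "e1 > 0" "e2 > 0" "ball x e1 \<subseteq> A" "ball x' e2 \<subseteq> B"
        using AB by (metis mem_Sigma_iff openE)
      obtain k where k: "inverse (Suc k) < min e1 e2"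
        using reals_Archimedean[of "min e1 e2"] e by auto
      \<comment> \<open>A finite set of return times could itself serve as F, and the pair would
        return outside it.\<close>
      have "?F \<in> \<F>"
        using fin by (auto simp: \<F>_def)
      then have "Q k ?F \<in> \<G>"
        unfolding \<G>_def by blast
      then have "(x, x') \<in> Q k ?F"
        using S(3)[OF x] by blast
      then obtain t where t: "t \<in> carrier T - ?F" "dist (a t x) x < inverse (Suc k)"
        "dist (a t x') x' < inverse (Suc k)"
        by (auto simp: Q_def)
      then have "a t x \<in> A" "a t x' \<in> B"
        using k e(3,4) by (auto simp: dist_commute subset_iff)
      then have "pair_action Z a t (x, x') \<in> V"
        using AB(4) xZ by (auto simp: pair_action_def)
      then show False
        using t(1) by blast
    qed
  qed
  then have "strongly_scrambled T Z a S"
    using S(1) K(2) by (auto simp: strongly_scrambled_def)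
  then show thesis
    using that S by blast
qed

subsection \<open>Minimal tuples in a fibre\<close>

context minimal_extension
begin

lemma compact_fiber: "compact (fiber X \<pi> y)"
proof -
  have "closedin (top_of_set X) {x \<in> X. \<pi> x = y}"
    by (rule continuous_closedin_preimage_constant[OF factor(1)])
  then show ?thesis
    using closedin_compact compact_phase by (auto simp: fiber_def)
qed

lemma power_orbit_closure_fiber:
  assumes w: "w \<in> power_space X m" "\<And>i. i < m \<Longrightarrow> \<pi> (w i) = y"
    and v: "v \<in> orbit_closure T (power_action X m \<phi>) w" and ij: "i < m" "j < m"
  shows "\<pi> (v i) = \<pi> (v j)"
  using power_orbit_closure_eq[OF factor(1) w(1) ij _ v] w(2) ij factor(3) power_space_nth[OF w(1)]
  by metis

lemma coordinate_orbit_closure: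
  assumes z: "z \<in> power_space X m" and "0 < m"
  shows "(\<lambda>v. v 0) ` orbit_closure T (power_action X m \<phi>) z = X"
proof -
  have "orbit_closure T \<phi> (z 0) = (\<lambda>v. v 0) ` orbit_closure T (power_action X m \<phi>) z"
    by (rule compact_action.orbit_closure_image[OF power_compact_action _ _ z])
       (use assms in \<open>auto simp: power_action_apply
         intro: continuous_on_subset[OF continuous_on_product_coordinates]\<close>)
  then show ?thesis
    using dense_orbits power_space_nth[OF z assms(2)] by simp
qed

text \<open>The base point can be prescribed: on the orbit closure of a minimal tuple the first
  coordinate takes all values in X, and the other coordinates stay in its fibre.\<close>

lemma minimal_tuple_over:
  assumes w: "w \<in> power_space X m" "\<And>i. i < m \<Longrightarrow> \<pi> (w i) = y'" and m: "0 < m" and y: "y \<in> Y"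
  obtains v where "v \<in> orbit_closure T (power_action X m \<phi>) w"
    "orbit_minimal T (power_action X m \<phi>) v" "\<And>i. i < m \<Longrightarrow> \<pi> (v i) = y"
proof -
  interpret P: compact_action T "power_space X m" "power_action X m \<phi>"
    by (rule power_compact_action)
  obtain u where u: "u \<in> orbit_closure T (power_action X m \<phi>) w"
    "orbit_minimal T (power_action X m \<phi>) u"
    using P.ex_orbit_minimal[OF w(1)] by blast
  have uX: "u \<in> power_space X m"
    using u(1) P.orbit_closure_subset[OF w(1)] by blast
  obtain x where x: "x \<in> X" "\<pi> x = y"
    using onto y by blast
  then have "x \<in> (\<lambda>v. v 0) ` orbit_closure T (power_action X m \<phi>) u"
    using coordinate_orbit_closure[OF uX m] by simp
  then obtain v where v: "v \<in> orbit_closure T (power_action X m \<phi>) u" "\<pi> (v 0) = y"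
    using x(2) by auto
  have vw: "v \<in> orbit_closure T (power_action X m \<phi>) w"
    using v(1) P.orbit_closure_mono[OF w(1) u(1)] by blast
  have "\<pi> (v i) = y" if "i < m" for i
    using power_orbit_closure_fiber[OF w vw that m] v(2) by simp
  then show thesis
    using that vw P.orbit_minimal_orbit_closure[OF uX u(2) v(1)] by blast
qed

text \<open>Distal points keep a positive distance along the orbit, so a minimal tuple in the orbit
  closure of S, taken over the same y, still has card S distinct coordinates; these form an almost
  periodic set.\<close>

lemma distal_bound:
  assumes bound: "\<And>A. A \<subseteq> fiber X \<pi> y \<Longrightarrow> almost_periodic_set T X \<phi> A \<Longrightarrow> finite A \<and> card A \<le> n"
    and y: "y \<in> Y" and S: "S \<subseteq> fiber X \<pi> y" "finite S"
    and distal: "\<And>x x'. x \<in> S \<Longrightarrow> x' \<in> S \<Longrightarrow> x \<noteq> x' \<Longrightarrow> \<not> proximal_pair T \<phi> x x'"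
  shows "card S \<le> n"
proof (cases "card S = 0")
  case False
  define m where "m = card S"
  obtain f where f: "bij_betw f {..<m} S"
    using ex_bij_betw_nat_finite[OF S(2)] by (auto simp: m_def atLeast0LessThan)
  define w where "w = restrict f {..<m}"
  have wS: "w i \<in> S" if "i < m" for i
    using f that by (auto simp: w_def bij_betw_def)
  have w: "w \<in> power_space X m" "\<And>i. i < m \<Longrightarrow> \<pi> (w i) = y"
    using wS S(1) by (auto simp: power_space_def fiber_def w_def)
  obtain v where v: "v \<in> orbit_closure T (power_action X m \<phi>) w"
    "orbit_minimal T (power_action X m \<phi>) v" "\<And>i. i < m \<Longrightarrow> \<pi> (v i) = y"
    using minimal_tuple_over[OF w _ y] False by (auto simp: m_def)
  have vX: "v \<in> power_space X m"
    using v(1) mem_power_orbit_closure_iff[OF w(1)] by blast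
  have "inj_on v {..<m}"
  proof (rule inj_onI, rule ccontr)
    fix i j
    assume ij: "i \<in> {..<m}" "j \<in> {..<m}" "v i = v j" "i \<noteq> j"
    then have "w i \<noteq> w j"
      using f by (auto simp: w_def bij_betw_def inj_on_def)
    then have "\<not> proximal_pair T \<phi> (w i) (w j)"
      using distal wS ij by simp
    then obtain k where k: "\<And>t. t \<in> carrier T \<Longrightarrow> inverse (Suc k) \<le> dist (\<phi> t (w i)) (\<phi> t (w j))"
      unfolding proximal_pair_iff by (meson not_less)
    have "inverse (Suc k) / 2 > (0::real)"
      by simp
    then obtain t where "t \<in> carrier T" "\<forall>i<m. dist (\<phi> t (w i)) (v i) < inverse (Suc k) / 2"
      using v(1) mem_power_orbit_closure_iff[OF w(1)] by metis
    then have "dist (\<phi> t (w i)) (v i) < inverse (Suc k) / 2"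
      "dist (\<phi> t (w j)) (v i) < inverse (Suc k) / 2" "t \<in> carrier T"
      using ij by auto
    then show False
      using k[of t] dist_triangle2[of "\<phi> t (w i)" "\<phi> t (w j)" "v i"] by linarith
  qed
  moreover have "v ` {..<m} \<subseteq> fiber X \<pi> y"
    using vX v(3) power_space_nth by (auto simp: fiber_def)
  ultimately show ?thesis
    using bound[of "v ` {..<m}"] almost_periodic_set_of_tuple[OF vX v(2)]
    by (simp add: card_image m_def)
qed simp

text \<open>Maximality of N is known only over \<open>y0\<close>; minimal tuples over other base
  points are compared by moving within their orbit closures to \<open>y0\<close> and back.\<close>

lemma ex_tuple_extension:
  assumes y0: "y0 \<in> Y"
    and bound: "\<And>A. A \<subseteq> fiber X \<pi> y0 \<Longrightarrow> almost_periodic_set T X \<phi> A \<Longrightarrow> finite A \<and> card A \<le> n"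
  obtains N M \<delta> where "tuple_extension T X \<phi> Y \<psi> \<pi> N M \<delta>"
proof -
  define Q where "Q m \<longleftrightarrow> (\<exists>w\<in>power_space X m. inj_on w {..<m} \<and> (\<forall>i<m. \<pi> (w i) = y0) \<and>
    orbit_minimal T (power_action X m \<phi>) w)" for m
  have Q_bound: "m \<le> n" if Q: "Q m" for m
  proof -
    obtain w where w: "w \<in> power_space X m" "inj_on w {..<m}" "\<forall>i<m. \<pi> (w i) = y0"
      "orbit_minimal T (power_action X m \<phi>) w"
      using Q unfolding Q_def by blast
    have "w ` {..<m} \<subseteq> fiber X \<pi> y0"
      using w power_space_nth by (auto simp: fiber_def)
    then show ?thesis
      using bound[OF _ almost_periodic_set_of_tuple[OF w(1,4)]] w(2) by (simp add: card_image)
  qed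
  have "Q 1"
  proof -
    obtain x where x: "x \<in> X" "\<pi> x = y0"
      using onto y0 by blast
    let ?w = "\<lambda>i\<in>{..<1::nat}. x"
    have w: "?w \<in> power_space X 1" "\<And>i. i < 1 \<Longrightarrow> \<pi> (?w i) = y0"
      using x by (auto simp: power_space_def)
    obtain v where v: "v \<in> orbit_closure T (power_action X 1 \<phi>) ?w"
      "orbit_minimal T (power_action X 1 \<phi>) v" "\<And>i. i < 1 \<Longrightarrow> \<pi> (v i) = y0"
      using minimal_tuple_over[OF w zero_less_one y0] by blast
    have "v \<in> power_space X 1"
      using v(1) mem_power_orbit_closure_iff[OF w(1)] by blast
    then show ?thesis
      using v unfolding Q_def by (intro bexI[of _ v]) (auto simp: inj_on_def)
  qed
  define N where "N = (GREATEST m. Q m)"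
  have N: "Q N" "\<And>m. Q m \<Longrightarrow> m \<le> N"
    unfolding N_def using GreatestI_nat[of Q 1 n] Greatest_le_nat[of Q _ n] Q_bound \<open>Q 1\<close> by blast+
  have N0: "0 < N"
    using N(2)[OF \<open>Q 1\<close>] by simp
  obtain z0 where z0: "z0 \<in> power_space X N" "inj_on z0 {..<N}" "\<And>i. i < N \<Longrightarrow> \<pi> (z0 i) = y0"
    "orbit_minimal T (power_action X N \<phi>) z0"
    using N(1) by (auto simp: Q_def)
  interpret P: compact_action T "power_space X N" "power_action X N \<phi>"
    by (rule power_compact_action)
  define M where "M = orbit_closure T (power_action X N \<phi>) z0"
  have M: "M \<subseteq> power_space X N" "compact M"
    unfolding M_def by (rule P.orbit_closure_subset[OF z0(1)], rule P.compact_orbit_closure[OF z0(1)])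
  have M_min: "orbit_minimal T (power_action X N \<phi>) z" if "z \<in> M" for z
    using P.orbit_minimal_orbit_closure[OF z0(1,4)] that by (simp add: M_def)
  have M_fiber: "\<pi> (z i) = \<pi> (z 0)" if "z \<in> M" "i < N" for z i
    using power_orbit_closure_fiber[OF z0(1,3) _ that(2) N0] that(1) by (simp add: M_def)
  have M_inj: "z i \<noteq> z j" if z: "z \<in> M" and ij: "i < N" "j < N" "i \<noteq> j" for z i j
  proof
    assume eq: "z i = z j"
    have "z0 \<in> orbit_closure T (power_action X N \<phi>) z"
      using z z0(4) by (auto simp: M_def orbit_minimal_def)
    then have "z0 i = z0 j"
      using power_orbit_closure_eq[OF continuous_on_id, of z N i j z0] eq z M(1) ij by auto
    then show False
      using z0(2) ij by (auto simp: inj_on_def)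
  qed
  \<comment> \<open>Asserted for all i and j, with 1 where it is vacuous, so that a total function d
    can be chosen.\<close>
  have "\<exists>d>0. \<forall>z\<in>M. i < N \<longrightarrow> j < N \<longrightarrow> i \<noteq> j \<longrightarrow> d \<le> dist (z i) (z j)" for i j
  proof (cases "i < N \<and> j < N \<and> i \<noteq> j")
    case True
    have cont: "continuous_on M (\<lambda>z. dist (z i) (z j))"
      by (intro continuous_on_dist continuous_on_subset[OF continuous_on_product_coordinates]) auto
    have "M \<noteq> {}"
      using P.orbit_closure_self[OF z0(1)] by (auto simp: M_def)
    then obtain z where "z \<in> M" "\<forall>u\<in>M. dist (z i) (z j) \<le> dist (u i) (u j)"
      using continuous_attains_inf[OF M(2) _ cont] by blast
    then show ?thesis
      using M_inj True by (intro exI[of _ "dist (z i) (z j)"]) auto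
  qed (auto intro: exI[of _ 1])
  then obtain d where d: "\<And>i j. d i j > 0"
    "\<And>i j z. z \<in> M \<Longrightarrow> i < N \<Longrightarrow> j < N \<Longrightarrow> i \<noteq> j \<Longrightarrow> d i j \<le> dist (z i) (z j)"
    by metis
  define D where "D = insert 1 ((\<lambda>(i, j). d i j) ` ({..<N} \<times> {..<N}))"
  have D: "finite D" "Min D > 0"
    using d(1) by (auto simp: D_def)
  have sep: "Min D \<le> dist (z i) (z j)" if "z \<in> M" "i < N" "j < N" "i \<noteq> j" for z i j
  proof -
    have "d i j \<in> D"
      using that unfolding D_def by blast
    then have "Min D \<le> d i j"
      using D(1) by simp
    then show ?thesis
      using d(2)[OF that] by simp
  qed
  have collapse: "\<exists>s\<in>carrier T. (\<forall>i<N. dist (\<phi> s (z i)) (z i) < e) \<and>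
      (\<forall>c\<in>C. \<exists>i<N. dist (\<phi> s c) (z i) < e)"
    if z: "z \<in> M" and C: "finite C" "C \<subseteq> fiber X \<pi> (\<pi> (z 0))" and e: "0 < e" for z C and e :: real
  proof -
    define k where "k = card C"
    obtain c where c: "bij_betw c {..<k} C"
      using ex_bij_betw_nat_finite[OF C(1)] by (auto simp: k_def atLeast0LessThan)
    \<comment> \<open>z followed by the points of C, so that a single translation handles
      both.\<close>
    define w where "w = (\<lambda>i\<in>{..<N + k}. if i < N then z i else c (i - N))"
    have zX: "z \<in> power_space X N"
      using z M(1) by blast
    have c_in: "c i \<in> C" if "i < k" for i
      using c that by (auto simp: bij_betw_def)
    have w_in: "w i \<in> fiber X \<pi> (\<pi> (z 0))" if "i < N + k" for i
    proof (cases "i < N")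
      case True
      then show ?thesis
        using M_fiber[OF z True] power_space_nth[OF zX True] that by (simp add: w_def fiber_def)
    next
      case False
      then show ?thesis
        using c_in[of "i - N"] C(2) that by (auto simp: w_def)
    qed
    have w: "w \<in> power_space X (N + k)" "\<And>i. i < N + k \<Longrightarrow> \<pi> (w i) = \<pi> (z 0)"
      using w_in by (auto simp: power_space_def fiber_def w_def)
    interpret R: compact_action T "power_space X (N + k)" "power_action X (N + k) \<phi>"
      by (rule power_compact_action)
    define h where "h v = (\<lambda>i\<in>{..<N}. v i)" for v :: "nat \<Rightarrow> 'x"
    have h: "orbit_closure T (power_action X N \<phi>) (h v) = h ` orbit_closure T (power_action X (N + k) \<phi>) v"
      if "v \<in> power_space X (N + k)" for v
      using R.orbit_closure_image[of h "power_action X N \<phi>" v] that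
        reindex_equivariant[of N id "N + k"] by (simp add: h_def[abs_def])
    have hw: "h w = z"
      by (rule power_space_eqI[OF _ zX])
         (use power_space_nth[OF zX] in \<open>auto simp: h_def w_def power_space_def\<close>)
    obtain u where u: "u \<in> orbit_closure T (power_action X (N + k) \<phi>) w"
      "orbit_minimal T (power_action X (N + k) \<phi>) u"
      using R.ex_orbit_minimal[OF w(1)] by blast
    have uX: "u \<in> power_space X (N + k)"
      using u(1) R.orbit_closure_subset[OF w(1)] by blast
    have "h u \<in> orbit_closure T (power_action X N \<phi>) z"
      using u(1) unfolding h[OF w(1), unfolded hw] by blast
    then have "z \<in> orbit_closure T (power_action X N \<phi>) (h u)"
      using M_min[OF z] by (simp add: orbit_minimal_def)
    \<comment> \<open>Minimality of z leads from the first block \<open>h u\<close> back to z, so a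
      minimal v can be chosen whose first N coordinates are exactly those of z.\<close>
    then have "z \<in> h ` orbit_closure T (power_action X (N + k) \<phi>) u"
      unfolding h[OF uX] .
    then obtain v where v: "v \<in> orbit_closure T (power_action X (N + k) \<phi>) u" "h v = z"
      by blast
    have vw: "v \<in> orbit_closure T (power_action X (N + k) \<phi>) w"
      using v(1) R.orbit_closure_mono[OF w(1) u(1)] by blast
    have vX: "v \<in> power_space X (N + k)"
      using vw R.orbit_closure_subset[OF w(1)] by blast
    have v_min: "orbit_minimal T (power_action X (N + k) \<phi>) v"
      by (rule R.orbit_minimal_orbit_closure[OF uX u(2) v(1)])
    have v_fiber: "\<pi> (v i) = \<pi> (v 0)" if "i < N + k" for i
      using power_orbit_closure_fiber[OF w vw that] N0 by simp
    obtain v' where v': "v' \<in> orbit_closure T (power_action X (N + k) \<phi>) v"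
      "orbit_minimal T (power_action X (N + k) \<phi>) v'" "\<And>i. i < N + k \<Longrightarrow> \<pi> (v' i) = y0"
      using minimal_tuple_over[OF vX v_fiber _ y0] N0 by auto
    have v'X: "v' \<in> power_space X (N + k)"
      using v'(1) R.orbit_closure_subset[OF vX] by blast
    have "h v' \<in> orbit_closure T (power_action X N \<phi>) z"
      using v'(1) unfolding h[OF vX, unfolded v(2)] by blast
    then have "h v' \<in> M"
      using P.orbit_closure_mono[OF z0(1)] z by (auto simp: M_def)
    then have "inj_on v' {..<N}"
      using M_inj[of "h v'"] by (auto simp: inj_on_def h_def)
    then have card: "card (v' ` {..<N}) = N"
      by (simp add: card_image)
    define A where "A = v' ` {..<N + k}"
    \<comment> \<open>The distinct coordinates of v' form a minimal tuple over \<open>y0\<close>, so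
      there are at most N; the first block already has N, hence the appended coordinates repeat
      it.\<close>
    have "card A \<le> N"
    proof (rule N(2))
      obtain f where f: "bij_betw f {..<card A} A"
        using ex_bij_betw_nat_finite[of A] by (auto simp: A_def atLeast0LessThan)
      have "\<forall>i\<in>{..<card A}. \<exists>j<N + k. v' j = f i"
        using f by (force simp: A_def bij_betw_def)
      then obtain r where r: "\<And>i. i < card A \<Longrightarrow> r i < N + k" "\<And>i. i < card A \<Longrightarrow> v' (r i) = f i"
        by (metis lessThan_iff)
      let ?v = "\<lambda>i\<in>{..<card A}. v' (r i)"
      have "orbit_minimal T (power_action X (card A) \<phi>) ?v"
        by (rule orbit_minimal_reindex[OF v'X v'(2) r(1)])
      moreover have "?v \<in> power_space X (card A)"
        using r power_space_nth[OF v'X] by (auto simp: power_space_def)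
      moreover have "inj_on ?v {..<card A}"
        using f r(2) by (auto simp: bij_betw_def inj_on_def)
      moreover have "\<pi> (?v i) = y0" if "i < card A" for i
        using r(1)[OF that] v'(3) that by simp
      ultimately show "Q (card A)"
        unfolding Q_def by (intro bexI[of _ ?v] conjI allI impI)
    qed
    then have A: "A = v' ` {..<N}"
      using card by (intro card_seteq[symmetric]) (auto simp: A_def)
    have v_z: "\<exists>i<N. v l = z i" if l: "l < N + k" for l
    proof -
      have "v' l \<in> v' ` {..<N}"
        using A l by (auto simp: A_def)
      then obtain i where i: "i < N" "v' l = v' i"
        by auto
      \<comment> \<open>Minimality leads back from v' to v and preserves the coincidence of
        coordinates l and i.\<close>
      have "v \<in> orbit_closure T (power_action X (N + k) \<phi>) v'"
        using v_min v'(1) by (simp add: orbit_minimal_def)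
      then have "v l = v i"
        using power_orbit_closure_eq[OF continuous_on_id v'X l, of i v] i by simp
      then show ?thesis
        using i(1) v(2) by (intro exI[of _ i]) (auto simp: h_def)
    qed
    \<comment> \<open>s brings w close to v: the z-part returns to z, and C lands near coordinates
      of v, all of which are coordinates of z.\<close>
    obtain s where s: "s \<in> carrier T" "\<And>l. l < N + k \<Longrightarrow> dist (\<phi> s (w l)) (v l) < e"
      using vw e mem_power_orbit_closure_iff[OF w(1)] by blast
    show ?thesis
    proof (intro bexI[of _ s] conjI allI impI ballI)
      show "dist (\<phi> s (z i)) (z i) < e" if "i < N" for i
        using s(2)[of i] v(2) that by (auto simp: h_def w_def)
      show "\<exists>i<N. dist (\<phi> s x) (z i) < e" if x: "x \<in> C" for x
      proof -
        obtain i where i: "i < k" "c i = x"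
          using c x by (auto simp: bij_betw_def)
        then show ?thesis
          using s(2)[of "N + i"] v_z[of "N + i"] by (auto simp: w_def)
      qed
    qed (rule s(1))
  qed
  have "tuple_extension T X \<phi> Y \<psi> \<pi> N M (Min D)"
  proof
    show "power_action X N \<phi> t z \<in> M" if "t \<in> carrier T" "z \<in> M" for t z
      using P.orbit_closure_act[OF z0(1) _ that(1)] that(2) by (simp add: M_def)
    show "\<exists>z\<in>M. z 0 = x" if "x \<in> X" for x
    proof -
      have "x \<in> (\<lambda>v. v 0) ` M"
        using coordinate_orbit_closure[OF z0(1) N0] that by (simp add: M_def)
      then show ?thesis
        by blast
    qed
  qed (fact N0 M M_fiber D(2) sep collapse)+
  then show thesis
    using that by blast
qed

end

theorem theorem5p2:
  fixes T :: "('t, 'r) monoid_scheme"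
    and X :: "'x::metric_space set" and \<phi> :: "'t \<Rightarrow> 'x \<Rightarrow> 'x"
    and Y :: "'y::metric_space set" and \<psi> :: "'t \<Rightarrow> 'y \<Rightarrow> 'y"
    and \<pi> :: "'x \<Rightarrow> 'y"
  assumes "group T" and "infinite (carrier T)" and "countable (carrier T)"
    and "minimal_flow T X \<phi>" and "minimal_flow T Y \<psi>"
    and "extension T X \<phi> Y \<psi> \<pi>"
    and "almost_proximal T X \<phi> Y \<pi>"
  shows "almost_finite_to_one X Y \<pi> \<or>
    (\<exists>Y\<^sub>0. residual_in Y Y\<^sub>0 \<and>
      (\<forall>y\<in>Y\<^sub>0. \<exists>S\<subseteq>fiber X \<pi> y. uncountable S \<and> strongly_scrambled T X \<phi> S))"
proof (cases "almost_finite_to_one X Y \<pi> \<or> Y = {}")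
  case True
  \<comment> \<open>Over an empty Y the first alternative fails for want of a point, but the empty
    set is residual.\<close>
  have "residual_in Y {}" if "Y = {}"
    using that by (auto simp: residual_in_def)
  then show ?thesis
    using True by blast
next
  case False
  then have infinite_fibers: "infinite (fiber X \<pi> y)" if "y \<in> Y" for y
    using that by (auto simp: almost_finite_to_one_def)
  obtain y0 where y0: "y0 \<in> Y"
    using False by blast
  interpret minimal_extension T X \<phi> Y \<psi> \<pi>
  proof (intro minimal_extension.intro minimal_extension_axioms.intro)
    show "compact_action T X \<phi>" "compact_action T Y \<psi>"
      using assms(4,5) by (auto simp: minimal_flow_def intro: flow_compact_action)
    show "orbit_closure T \<phi> x = X" if "x \<in> X" for x
      using assms(4) that by (simp add: minimal_flow_def orbit_closure_def)
  qed (use assms(6) in \<open>auto simp: extension_def\<close>)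
  have bound: "\<exists>n. \<forall>A. A \<subseteq> fiber X \<pi> y \<longrightarrow> almost_periodic_set T X \<phi> A \<longrightarrow> finite A \<and> card A \<le> n"
    if "y \<in> Y" for y
    using assms(7) that by (auto simp: almost_proximal_def)
  obtain N M \<delta> where "tuple_extension T X \<phi> Y \<psi> \<pi> N M \<delta>"
    using bound[OF y0] ex_tuple_extension[OF y0] by metis
  then interpret tuple_extension T X \<phi> Y \<psi> \<pi> N M \<delta> .
  obtain R where R: "residual_in Y R" "\<And>y. y \<in> R \<Longrightarrow> open_at y"
    "\<And>p U. p \<in> E \<Longrightarrow> proj p \<in> R \<Longrightarrow> open U \<Longrightarrow> p \<in> U \<Longrightarrow>
      \<exists>q\<in>E \<inter> U. proj q = proj p \<and> transitive q"
    using generic_transitive by blast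
  have "\<exists>S\<subseteq>fiber X \<pi> y. uncountable S \<and> strongly_scrambled T X \<phi> S" if y: "y \<in> R" for y
  proof -
    have yY: "y \<in> Y"
      using y R(1) by (auto simp: residual_in_def)
    have trans: "\<exists>q\<in>E \<inter> U. proj q = y \<and> transitive q"
      if "p \<in> E" "proj p = y" "open U" "p \<in> U" for p U
      using R(3)[of p U] that y by simp
    obtain n where n: "\<And>A. A \<subseteq> fiber X \<pi> y \<Longrightarrow> almost_periodic_set T X \<phi> A \<Longrightarrow> finite A \<and> card A \<le> n"
      using bound[OF yY] by blast
    obtain S where "S \<subseteq> fiber X \<pi> y" "uncountable S" "strongly_scrambled T X \<phi> S"
    proof (rule uncountable_strongly_scrambled[OF assms(3) compact_fiber])
      show "fiber X \<pi> y \<subseteq> X" "fiber X \<pi> y \<noteq> {}"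
        using onto[OF yY] by (auto simp: fiber_def)
      show "infinite (V \<inter> fiber X \<pi> y)" if "open V" "V \<inter> fiber X \<pi> y \<noteq> {}" for V
        by (rule generic_fiber_perfect[OF R(2)[OF y] infinite_fibers[OF yY] trans that])
      show "\<exists>x\<in>V \<inter> fiber X \<pi> y. \<exists>x'\<in>W \<inter> fiber X \<pi> y.
          recurrent_point T (pair_action X \<phi>) (x, x')"
        if "open V" "V \<inter> fiber X \<pi> y \<noteq> {}" "open W" "W \<inter> fiber X \<pi> y \<noteq> {}" for V W
        by (rule generic_recurrent[OF R(2)[OF y] infinite_fibers[OF yY] trans that]) blast+
      show "card S \<le> n"
        if "S \<subseteq> fiber X \<pi> y" "finite S"
          "\<And>x x'. x \<in> S \<Longrightarrow> x' \<in> S \<Longrightarrow> x \<noteq> x' \<Longrightarrow> \<not> proximal_pair T \<phi> x x'" for S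
        by (rule distal_bound[OF n yY that])
    qed
    then show ?thesis
      by blast
  qed
  then show ?thesis
    using R(1) by blast
qed

end
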